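(* Let $p\geq 5$ be an odd prime and let $\varphi:\mathbb{Z}/p\mathbb{Z}\to\mathbb{C}^\times$ be the character $\varphi(j)=\zeta^j$, $\zeta=e^{2\pi i/p}$. Then the restriction $\rho_1|_{H_2}$ of the $\mathrm{SO}(p)_2$-TQFT representation of $\mathrm{SL}(2,\mathbb{Z})$ to $H_2$ factors through $W_\varphi^{even}$, the even part of the Weil representation of $\mathrm{SL}(2,\mathbb{Z}/p\mathbb{Z})$ associated to $\varphi$. That is, if $\Phi:H_2\to E^{even}$ is the linear isomorphism with $\Phi(\mathbf{1}+\mathbf{Z})=2f_0$ and $\Phi(\mathbf{Y}_j)=f_j+f_{-j}$ for $1\le j\le r$, then for every $\gamma\in\mathrm{SL}(2,\mathbb{Z})$, $$\Phi\circ \rho_1|_{H_2}(\gamma)\circ\Phi^{-1}=W_\varphi^{even}(\gamma \bmod p)\quad\text{in } \mathrm{PGL}(E^{even}).$$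
   Context: Let $r=\frac{p-1}{2}$, $\zeta=e^{2\pi i/p}$, $\psi=e^{2\pi i r/8}$, and $\theta_j=\zeta^{rj^2}$ for $j\in\mathbb{Z}$. The TQFT representation. Let $H$ be the complex vector space of dimension $r+4$ with fixed basis $\mathbf{1},\mathbf{Z},\mathbf{Y}_1,\dots,\mathbf{Y}_r,\mathbf{X},\mathbf{X}'$ (the simple objects of the modular category $\mathrm{SO}(p)_2$). Let $\sigma=\begin{bmatrix}0&-1\\1&0\end{bmatrix}$, $\tau=\begin{bmatrix}1&1\\0&1\end{bmatrix}$ be generators of $\mathrm{SL}(2,\mathbb{Z})$. The genus one representation of the $\mathrm{SO}(p)_2$-TQFT is the projective representation $\rho_1:\mathrm{SL}(2,\mathbb{Z})\to\mathrm{PGL}(H)$ given on generators by the classes of the linear maps $\rho_1(\sigma)\mathbf{1}=\frac{1}{2\sqrt p}(\mathbf{1}+\mathbf{Z})+\frac{1}{\sqrt p}\sum_{k=1}^r\mathbf{Y}_k+\frac12(\mathbf{X}+\mathbf{X}')$, $\rho_1(\sigma)\mathbf{Z}=\frac{1}{2\sqrt p}(\mathbf{1}+\mathbf{Z})+\frac{1}{\sqrt p}\sum_{k=1}^r\mathbf{Y}_k-\frac12(\mathbf{X}+\mathbf{X}')$, $\rho_1(\sigma)\mathbf{Y}_j=\frac{1}{\sqrt p}(\mathbf{1}+\mathbf{Z})+\sum_{k=1}^r A_{kj}\mathbf{Y}_k$ with $A_{jk}=\frac{1}{\sqrt p}(\zeta^{jk}+\zeta^{-jk})$, $\rho_1(\sigma)\mathbf{X}=\frac12(\mathbf{1}-\mathbf{Z})+\frac12(\mathbf{X}-\mathbf{X}')$,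 $\rho_1(\sigma)\mathbf{X}'=\frac12(\mathbf{1}-\mathbf{Z})-\frac12(\mathbf{X}-\mathbf{X}')$; and $\rho_1(\tau)$ diagonal with $\mathbf{1}\mapsto\mathbf{1}$, $\mathbf{Z}\mapsto\mathbf{Z}$, $\mathbf{Y}_j\mapsto\theta_j\mathbf{Y}_j$, $\mathbf{X}\mapsto\psi\mathbf{X}$, $\mathbf{X}'\mapsto-\psi\mathbf{X}'$. The subspace $H_2=\mathrm{span}_{\mathbb{C}}\{\mathbf{1}+\mathbf{Z},\mathbf{Y}_1,\dots,\mathbf{Y}_r\}$ is invariant, and $\rho_1|_{H_2}:\mathrm{SL}(2,\mathbb{Z})\to\mathrm{PGL}(H_2)$ denotes the restricted projective representation. The Weil representation. The Heisenberg group is $\mathcal{H}_p=\{h(x,y,z)=\begin{bmatrix}1&y&z\\0&1&x\\0&0&1\end{bmatrix}: x,y,z\in\mathbb{Z}/p\mathbb{Z}\}$ under matrix multiplication; its center is $\{h(0,0,z)\}\cong\mathbb{Z}/p\mathbb{Z}$ and $h(x,y,z)\mapsto(x,y)^t$ is the quotient map to $(\mathbb{Z}/p\mathbb{Z})^2$. The standard action of $\mathrm{SL}(2,\mathbb{Z}/p\mathbb{Z})$ on column vectors $(x,y)^t$ lifts to an action on $\mathcal{H}_p$ by automorphisms trivial on the center, via a suitable section of the quotient map; explicitly, $\begin{bmatrix}a&b\\c&d\end{bmatrix}$ sends $h(x,y,z)$ to $h(x',y',z-\tfrac{xy}{2}+\tfrac{x'y'}{2})$ with $x'=ax+by$, $y'=cx+dy$.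 Let $\mathcal{L}^2(\mathbb{Z}/p\mathbb{Z})$ be the space of complex-valued functions on $\mathbb{Z}/p\mathbb{Z}$, with basis $f_j(x)=\delta_{j,x}$, $j\in\mathbb{Z}/p\mathbb{Z}$. For a nontrivial character $\varphi$ of $\mathbb{Z}/p\mathbb{Z}$, let $\pi_\varphi:\mathcal{H}_p\to\mathrm{GL}(\mathcal{L}^2(\mathbb{Z}/p\mathbb{Z}))$ be the (irreducible) representation $(\pi_\varphi(h(x,y,z))f)(a)=\varphi(-xa+z)f(a-y)$. For $\alpha\in\mathrm{SL}(2,\mathbb{Z}/p\mathbb{Z})$, $W_\varphi(\alpha)$ is the invertible operator, unique up to scalar, with $W_\varphi(\alpha)\pi_\varphi(h)=\pi_\varphi(\alpha(h))W_\varphi(\alpha)$ for all $h\in\mathcal{H}_p$. The resulting projective representation $W_\varphi:\mathrm{SL}(2,\mathbb{Z}/p\mathbb{Z})\to\mathrm{PGL}(\mathcal{L}^2(\mathbb{Z}/p\mathbb{Z}))$ is the Weil representation. In the basis $(f_j)$ and up to scalars, $W_\varphi(\sigma)=(\varphi(jk))_{0\le j,k\le p-1}$ and $W_\varphi(\tau)=\mathrm{diag}(\varphi(-\tfrac{j^2}{2}))_{0\le j\le p-1}$, with $\frac12$ the inverse of $2$ in $\mathbb{Z}/p\mathbb{Z}$. The subspace $E^{even}=\mathrm{span}_{\mathbb{C}}\{f_k+f_{p-k}:k=0,\dots,r\}$ (with $f_p=f_0$) is invariant, and $W_\varphi^{even}:\mathrm{SL}(2,\mathbb{Z}/p\mathbb{Z})\to\mathrm{PGL}(E^{even})$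 is the restriction of $W_\varphi$ to it. *)

theory Defs
  imports
    "HOL-Analysis.Analysis"
    "HOL-Algebra.Bij"
    "HOL-Algebra.Coset"
    "HOL-Library.Function_Algebras"
    "Berlekamp_Zassenhaus.Finite_Field"
begin

section \<open>Linear groups of spaces of complex-valued functions\<close>

definition fscale :: "complex \<Rightarrow> ('i \<Rightarrow> complex) \<Rightarrow> 'i \<Rightarrow> complex" (infixr "*\<^sub>F" 75)
  where "c *\<^sub>F v = (\<lambda>i. c * v i)"

global_interpretation fun_space: vector_space fscale
  by unfold_locales (auto simp: fscale_def fun_eq_iff algebra_simps)

definition basis_vec :: "'i \<Rightarrow> 'i \<Rightarrow> complex"
  where "basis_vec i = (\<lambda>x. if x = i then 1 else 0)"

definition linear_on :: "('i \<Rightarrow> complex) set \<Rightarrow> (('i \<Rightarrow> complex) \<Rightarrow> ('j \<Rightarrow> complex)) \<Rightarrow> bool"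
  where "linear_on V M \<longleftrightarrow>
    (\<forall>v\<in>V. \<forall>w\<in>V. M (v + w) = M v + M w) \<and> (\<forall>c. \<forall>v\<in>V. M (c *\<^sub>F v) = c *\<^sub>F M v)"

text \<open>For a subspace \<open>V\<close>, an element of \<open>GL(V)\<close> is a linear bijection of \<open>V\<close>, made
  \<open>undefined\<close> outside \<open>V\<close>. An element of \<open>PGL(V)\<close> is a coset of the scalars, that is,
  the set of all nonzero multiples of one such map.\<close>

definition GL :: "('i \<Rightarrow> complex) set \<Rightarrow> (('i \<Rightarrow> complex) \<Rightarrow> ('i \<Rightarrow> complex)) monoid"
  where "GL V = (BijGroup V)\<lparr>carrier := {M \<in> Bij V. linear_on V M}\<rparr>"

definition scalars :: "('i \<Rightarrow> complex) set \<Rightarrow> (('i \<Rightarrow> complex) \<Rightarrow> ('i \<Rightarrow> complex)) set"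
  where "scalars V = {(\<lambda>v\<in>V. c *\<^sub>F v) | c. c \<noteq> 0}"

definition PGL :: "('i \<Rightarrow> complex) set \<Rightarrow> (('i \<Rightarrow> complex) \<Rightarrow> ('i \<Rightarrow> complex)) set monoid"
  where "PGL V = GL V Mod scalars V"

definition proj_class ::
    "('i \<Rightarrow> complex) set \<Rightarrow> (('i \<Rightarrow> complex) \<Rightarrow> ('i \<Rightarrow> complex)) \<Rightarrow> (('i \<Rightarrow> complex) \<Rightarrow> ('i \<Rightarrow> complex)) set"
  where "proj_class V M = scalars V #>\<^bsub>GL V\<^esub> M"

text \<open>These act on a projective class representative by representative. The first is meant
  for an invariant subspace \<open>U\<close>, the second for a linear isomorphism \<open>\<Phi>\<close> from \<open>U\<close>
  onto \<open>V\<close>.\<close>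

definition restrict_class ::
    "('i \<Rightarrow> complex) set \<Rightarrow> (('i \<Rightarrow> complex) \<Rightarrow> ('i \<Rightarrow> complex)) set \<Rightarrow> (('i \<Rightarrow> complex) \<Rightarrow> ('i \<Rightarrow> complex)) set"
  where "restrict_class U C = (\<lambda>M. restrict M U) ` C"

definition conj_class ::
    "('i \<Rightarrow> complex) set \<Rightarrow> ('j \<Rightarrow> complex) set \<Rightarrow> (('i \<Rightarrow> complex) \<Rightarrow> ('j \<Rightarrow> complex)) \<Rightarrow>
     (('i \<Rightarrow> complex) \<Rightarrow> ('i \<Rightarrow> complex)) set \<Rightarrow> (('j \<Rightarrow> complex) \<Rightarrow> ('j \<Rightarrow> complex)) set"
  where "conj_class U V \<Phi> C = (\<lambda>M. restrict (\<Phi> \<circ> M \<circ> inv_into U \<Phi>) V) ` C"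

section \<open>Special linear groups\<close>

definition SL2 :: "('a::comm_ring_1 ^ 2 ^ 2) monoid"
  where "SL2 = \<lparr>carrier = {A. det A = 1}, mult = (**), one = mat 1\<rparr>"

definition sigma :: "int ^ 2 ^ 2"
  where "sigma = vector [vector [0, -1], vector [1, 0]]"

definition tau :: "int ^ 2 ^ 2"
  where "tau = vector [vector [1, 1], vector [0, 1]]"

definition reduce_mod :: "int ^ 2 ^ 2 \<Rightarrow> 'p::prime_card mod_ring ^ 2 ^ 2"
  where "reduce_mod \<gamma> = map_matrix of_int \<gamma>"

section \<open>The genus one representation\<close>

definition half :: "nat \<Rightarrow> nat"
  where "half p = (p - 1) div 2"

definition zeta :: "nat \<Rightarrow> complex"
  where "zeta p = exp (2 * of_real pi * \<i> / of_nat p)"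

definition psi :: "nat \<Rightarrow> complex"
  where "psi p = exp (2 * of_real pi * \<i> * of_nat (half p) / 8)"

definition theta :: "nat \<Rightarrow> nat \<Rightarrow> complex"
  where "theta p j = zeta p ^ (half p * j\<^sup>2)"

text \<open>Labels of the simple objects; only \<open>ObjY 1, \<dots>, ObjY r\<close> with \<open>r = half p\<close> occur.\<close>

datatype obj = ObjI | ObjZ | ObjY nat | ObjX | ObjX'

definition objs :: "nat \<Rightarrow> obj set"
  where "objs p = {ObjI, ObjZ, ObjX, ObjX'} \<union> ObjY ` {1..half p}"

abbreviation "vI \<equiv> basis_vec ObjI"
abbreviation "vZ \<equiv> basis_vec ObjZ"
abbreviation "vY j \<equiv> basis_vec (ObjY j)"
abbreviation "vX \<equiv> basis_vec ObjX"
abbreviation "vX' \<equiv> basis_vec ObjX'"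

definition H :: "nat \<Rightarrow> (obj \<Rightarrow> complex) set"
  where "H p = fun_space.span (basis_vec ` objs p)"

definition H2 :: "nat \<Rightarrow> (obj \<Rightarrow> complex) set"
  where "H2 p = fun_space.span (insert (vI + vZ) {vY j | j. j \<in> {1..half p}})"

definition linear_ext :: "nat \<Rightarrow> (obj \<Rightarrow> (obj \<Rightarrow> complex)) \<Rightarrow> (obj \<Rightarrow> complex) \<Rightarrow> (obj \<Rightarrow> complex)"
  where "linear_ext p g = (\<lambda>v\<in>H p. \<Sum>b\<in>objs p. v b *\<^sub>F g b)"

fun sigma_image :: "nat \<Rightarrow> obj \<Rightarrow> (obj \<Rightarrow> complex)" where
  "sigma_image p ObjI =
     (1 / (2 * of_real (sqrt p))) *\<^sub>F (vI + vZ) + (1 / of_real (sqrt p)) *\<^sub>F (\<Sum>k = 1..half p. vY k)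
     + (1/2) *\<^sub>F (vX + vX')"
| "sigma_image p ObjZ =
     (1 / (2 * of_real (sqrt p))) *\<^sub>F (vI + vZ) + (1 / of_real (sqrt p)) *\<^sub>F (\<Sum>k = 1..half p. vY k)
     - (1/2) *\<^sub>F (vX + vX')"
| "sigma_image p (ObjY j) =
     (1 / of_real (sqrt p)) *\<^sub>F (vI + vZ)
     + (\<Sum>k = 1..half p.
          (1 / of_real (sqrt p) * (zeta p ^ (k * j) + inverse (zeta p) ^ (k * j))) *\<^sub>F vY k)"
| "sigma_image p ObjX = (1/2) *\<^sub>F (vI - vZ) + (1/2) *\<^sub>F (vX - vX')"
| "sigma_image p ObjX' = (1/2) *\<^sub>F (vI - vZ) - (1/2) *\<^sub>F (vX - vX')"

fun tau_image :: "nat \<Rightarrow> obj \<Rightarrow> (obj \<Rightarrow> complex)" where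
  "tau_image p ObjI = vI"
| "tau_image p ObjZ = vZ"
| "tau_image p (ObjY j) = theta p j *\<^sub>F vY j"
| "tau_image p ObjX = psi p *\<^sub>F vX"
| "tau_image p ObjX' = (- psi p) *\<^sub>F vX'"

text \<open>Since \<open>sigma\<close> and \<open>tau\<close> generate \<open>SL(2,\<int>)\<close>, this determines \<open>\<rho>\<close> on all of
  \<open>SL(2,\<int>)\<close>.\<close>

definition is_genus_one_rep ::
    "nat \<Rightarrow> (int ^ 2 ^ 2 \<Rightarrow> ((obj \<Rightarrow> complex) \<Rightarrow> (obj \<Rightarrow> complex)) set) \<Rightarrow> bool"
  where "is_genus_one_rep p \<rho> \<longleftrightarrow>
    \<rho> \<in> hom SL2 (PGL (H p)) \<and>
    \<rho> sigma = proj_class (H p) (linear_ext p (sigma_image p)) \<and>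
    \<rho> tau = proj_class (H p) (linear_ext p (tau_image p))"

section \<open>The Weil representation\<close>

definition heis :: "'a::field \<Rightarrow> 'a \<Rightarrow> 'a \<Rightarrow> 'a ^ 3 ^ 3"
  where "heis x y z = vector [vector [1, y, z], vector [0, 1, x], vector [0, 0, 1]]"

definition Heisenberg :: "('a::field ^ 3 ^ 3) monoid"
  where "Heisenberg = \<lparr>carrier = {heis x y z | x y z. True}, mult = (**), one = mat 1\<rparr>"

definition heis_act :: "'a::field ^ 2 ^ 2 \<Rightarrow> 'a ^ 3 ^ 3 \<Rightarrow> 'a ^ 3 ^ 3"
  where "heis_act \<alpha> h =
    (let x = h $ 2 $ 3; y = h $ 1 $ 2; z = h $ 1 $ 3;
         x' = \<alpha> $ 1 $ 1 * x + \<alpha> $ 1 $ 2 * y;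
         y' = \<alpha> $ 2 $ 1 * x + \<alpha> $ 2 $ 2 * y
     in heis x' y' (z - x * y / 2 + x' * y' / 2))"

definition heis_rep :: "('a::field \<Rightarrow> complex) \<Rightarrow> 'a ^ 3 ^ 3 \<Rightarrow> ('a \<Rightarrow> complex) \<Rightarrow> ('a \<Rightarrow> complex)"
  where "heis_rep \<phi> h f =
    (let x = h $ 2 $ 3; y = h $ 1 $ 2; z = h $ 1 $ 3
     in (\<lambda>a. \<phi> (- x * a + z) * f (a - y)))"

abbreviation L2 :: "('p::prime_card mod_ring \<Rightarrow> complex) set"
  where "L2 \<equiv> UNIV"

text \<open>The intertwining operator is unique up to a scalar, so the set of all invertible
  intertwining operators is its class in \<open>PGL\<close>.\<close>

definition weil ::
    "('p::prime_card mod_ring \<Rightarrow> complex) \<Rightarrow> 'p mod_ring ^ 2 ^ 2 \<Rightarrow>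
     (('p mod_ring \<Rightarrow> complex) \<Rightarrow> ('p mod_ring \<Rightarrow> complex)) set"
  where "weil \<phi> \<alpha> =
    {W \<in> carrier (GL L2).
       \<forall>h \<in> carrier Heisenberg. W \<circ> heis_rep \<phi> h = heis_rep \<phi> (heis_act \<alpha> h) \<circ> W}"

definition E_even :: "('p::prime_card mod_ring \<Rightarrow> complex) set"
  where "E_even = fun_space.span
    {basis_vec (of_nat k) + basis_vec (of_nat (CARD('p) - k)) | k. k \<in> {0..half CARD('p)}}"

definition weil_even ::
    "('p::prime_card mod_ring \<Rightarrow> complex) \<Rightarrow> 'p mod_ring ^ 2 ^ 2 \<Rightarrow>
     (('p mod_ring \<Rightarrow> complex) \<Rightarrow> ('p mod_ring \<Rightarrow> complex)) set"
  where "weil_even \<phi> \<alpha> = restrict_class E_even (weil \<phi> \<alpha>)"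

definition std_char :: "'p::prime_card mod_ring \<Rightarrow> complex"
  where "std_char j = zeta CARD('p) powi to_int_mod_ring j"

end

theory Submission
  imports Defs
begin

text \<open>
  On the subspace \<open>H2\<close> the genus one representation is the even part of the Weil representation
  because the modular data of the category are those of the finite Fourier transform. Under the
  identification \<open>\<Phi>\<close> the S-matrix becomes the normalised Fourier transform of even functions on
  \<open>\<int>/p\<int>\<close>, because \<open>\<zeta>\<^bsup>jk\<^esup> + \<zeta>\<^bsup>-jk\<^esup>\<close> is the sum of the two characters at \<open>\<plusminus>j\<close>
  (\<open>sigma_intertwines\<close>), and the T-matrix becomes multiplication by the quadratic phase
  \<open>\<phi> (- j\<^sup>2 / 2)\<close>, because \<open>r = (p - 1)/2\<close> is \<open>- 1/2\<close> modulo \<open>p\<close> (\<open>tau_intertwines\<close>). These two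
  operators are the intertwiners that the Weil representation attaches to the images of \<open>sigma\<close> and
  \<open>tau\<close> (\<open>fourier_in_weil\<close>, \<open>chirp_in_weil\<close>).

  Both sides are multiplicative, and \<open>sigma\<close> and \<open>tau\<close> generate \<open>SL(2,\<int>)\<close> as a monoid
  (\<open>SL2_int_induct\<close>), so for each \<open>\<gamma>\<close> there are a representative \<open>M\<close> of the genus one class and an
  intertwiner \<open>W\<close> with \<open>\<Phi> \<circ> M = W \<circ> \<Phi>\<close> on \<open>H2\<close> (\<open>genus_one_agrees_with_weil\<close>). The class of
  \<open>M\<close> consists of its nonzero multiples. So does the set of all intertwiners that contains \<open>W\<close>, by
  Schur's lemma for the Heisenberg representation (\<open>heis_rep_commutant_scalar\<close>,
  \<open>weil_eq_multiples\<close>). One matching pair therefore gives the equality of the two classes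
  (\<open>conj_class_eq_weil_even\<close>).
\<close>

section \<open>The standard additive character\<close>

text \<open>The character is defined through the representative in \<open>{0..<p}\<close>; since \<open>\<zeta>\<close> is a \<open>p\<close>-th root
of unity, any other integer representative may be used, and this is what makes it additive.\<close>

lemma std_char_of_int:
  "std_char (of_int n :: 'p::prime_card mod_ring) = zeta CARD('p) powi n"
proof -
  let ?z = "zeta CARD('p)" and ?p = "int CARD('p)"
  have z: "?z powi ?p = 1"
    by (simp add: zeta_def exp_of_nat_mult [symmetric] mult.commute)
  have nz: "?z \<noteq> 0" by (simp add: zeta_def)
  have "to_int_mod_ring (of_int (n mod ?p) :: 'p mod_ring) = n mod ?p"
    by (simp add: of_int_of_int_mod_ring del: of_int_mod_CHAR)
  moreover have "(of_int (n mod ?p) :: 'p mod_ring) = of_int n"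
    using of_int_mod_CHAR[where 'a = "'p mod_ring", of n] by simp
  ultimately have red: "to_int_mod_ring (of_int n :: 'p mod_ring) = n mod ?p" by simp
  have "?z powi n = ?z powi (?p * (n div ?p) + n mod ?p)" by simp
  also have "\<dots> = ?z powi (?p * (n div ?p)) * ?z powi (n mod ?p)"
    using nz by (intro power_int_add disjI1)
  also have "?z powi (?p * (n div ?p)) = 1"
    by (simp only: power_int_mult z power_int_1_left)
  finally show ?thesis by (simp add: std_char_def red)
qed

lemma std_char_of_nat: "std_char (of_nat n :: 'p::prime_card mod_ring) = zeta CARD('p) ^ n"
  using std_char_of_int[of "int n", where 'p = 'p] by simp

lemma ex_of_int_mod_ring: "\<exists>n. (a :: 'p::prime_card mod_ring) = of_int n"
  by (metis of_int_mod_ring_to_int_mod_ring of_int_of_int_mod_ring)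

lemma std_char_add: "std_char (a + b) = std_char a * std_char (b :: 'p::prime_card mod_ring)"
proof -
  obtain m n where "a = of_int m" "b = of_int n" using ex_of_int_mod_ring by metis
  then have "std_char (a + b) = zeta CARD('p) powi (m + n)"
    by (simp add: std_char_of_int flip: of_int_add)
  moreover have "zeta CARD('p) \<noteq> 0" by (simp add: zeta_def)
  ultimately show ?thesis
    using \<open>a = _\<close> \<open>b = _\<close> by (simp add: std_char_of_int power_int_add)
qed

lemma std_char_0 [simp]: "std_char 0 = 1"
  using std_char_of_nat[of 0] by simp

lemma std_char_minus: "std_char (- a) = inverse (std_char (a :: 'p::prime_card mod_ring))"
  using std_char_add[of a "- a"] by (simp add: inverse_unique)

lemma std_char_eq_1_iff: "std_char a = 1 \<longleftrightarrow> (a :: 'p::prime_card mod_ring) = 0"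
proof
  assume one: "std_char a = 1"
  obtain k where k: "k < CARD('p)" "a = of_nat k" using surj_of_nat_mod_ring by blast
  have "exp (2 * of_real pi * \<i> * (of_nat k / of_nat CARD('p))) = 1"
    using one by (simp add: k std_char_of_nat zeta_def exp_of_nat_mult [symmetric] field_simps)
  then obtain n :: int where "real k = of_int n * real CARD('p)"
    by (auto simp: exp_eq_1 field_simps)
  then have "real_of_int (int k) = of_int (n * int CARD('p))" by simp
  then have "int k = n * int CARD('p)" by (simp only: of_int_eq_iff)
  then have "int CARD('p) dvd int k" by simp
  then have "k = 0" using k(1) by (auto dest: dvd_imp_le)
  then show "a = 0" using k by simp
qed simp

text \<open>Replacing \<open>k\<close> by \<open>k + 1\<close> multiplies the sum by the value of the character at \<open>m\<close>, which is
different from \<open>1\<close> when \<open>m\<close> is nonzero.\<close>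

lemma std_char_orthogonality:
  "(\<Sum>k\<in>UNIV. std_char (k * m)) = (if (m :: 'p::prime_card mod_ring) = 0 then of_nat CARD('p) else 0)"
proof (cases "m = 0")
  case False
  let ?S = "\<Sum>k\<in>UNIV. std_char (k * m)"
  have "?S = (\<Sum>k\<in>UNIV. std_char ((k + 1) * m))"
    by (rule sum.reindex_bij_witness[of _ "\<lambda>k. k + 1" "\<lambda>k. k - 1"]) auto
  also have "\<dots> = (\<Sum>k\<in>UNIV. std_char m * std_char (k * m))"
    by (simp only: distrib_right std_char_add mult_1_left mult.commute[of "std_char m"])
  also have "\<dots> = std_char m * ?S"
    by (simp only: sum_distrib_left)
  finally show ?thesis using False by (auto simp: std_char_eq_1_iff)
qed simp

lemma two_neq_0_mod_ring:
  assumes "CARD('p::prime_card) \<ge> 3"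
  shows "(2 :: 'p mod_ring) \<noteq> 0"
proof
  assume "(2 :: 'p mod_ring) = 0"
  then have "CARD('p) dvd 2" using of_nat_0_mod_ring_dvd[of 2, where 'a = 'p] by simp
  then show False using assms by (auto dest: dvd_imp_le)
qed

section \<open>Generation of the modular group\<close>

lemma mat2_eq_iff:
  "A = B \<longleftrightarrow> A $ 1 $ 1 = B $ 1 $ 1 \<and> A $ 1 $ 2 = B $ 1 $ 2 \<and>
             A $ 2 $ 1 = B $ 2 $ 1 \<and> A $ 2 $ 2 = (B :: 'a ^ 2 ^ 2) $ 2 $ 2"
  by (auto simp: vec_eq_iff forall_2)

lemma mat2_mult_nth:
  "((A :: 'a::semiring_1 ^ 2 ^ 2) ** B) $ i $ j = A $ i $ 1 * B $ 1 $ j + A $ i $ 2 * B $ 2 $ j"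
  by (simp add: matrix_matrix_mult_def sum_2)

lemma sigma_nth [simp]: "sigma $ 1 $ 1 = 0" "sigma $ 1 $ 2 = -1" "sigma $ 2 $ 1 = 1" "sigma $ 2 $ 2 = 0"
  by (simp_all add: sigma_def)

lemma tau_nth [simp]: "tau $ 1 $ 1 = 1" "tau $ 1 $ 2 = 1" "tau $ 2 $ 1 = 0" "tau $ 2 $ 2 = 1"
  by (simp_all add: tau_def)

text \<open>The power \<open>tau\<^bsup>n\<^esup>\<close> for an integer exponent.\<close>

definition upper :: "int \<Rightarrow> int ^ 2 ^ 2"
  where "upper n = vector [vector [1, n], vector [0, 1]]"

lemma upper_nth [simp]:
  "upper n $ 1 $ 1 = 1" "upper n $ 1 $ 2 = n" "upper n $ 2 $ 1 = 0" "upper n $ 2 $ 2 = 1"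
  by (simp_all add: upper_def)

text \<open>\<open>SL(2,\<int>)\<close> is generated by \<open>sigma\<close> and \<open>tau\<close> even as a monoid, so a property that holds at the
two generators and passes to products holds everywhere. The reason is the Euclidean algorithm on the first column: a power of \<open>tau\<close> reduces the upper left entry
modulo the lower left one, and \<open>sigma\<close> exchanges the two up to sign. Inverses are
positive words because \<open>sigma\<close> has order \<open>4\<close> and \<open>sigma ** tau\<close> has order \<open>6\<close>.\<close>

lemma SL2_int_induct [consumes 1, case_names sigma tau mult]:
  fixes \<gamma> :: "int ^ 2 ^ 2"
  assumes "det \<gamma> = 1"
    and sigma: "P sigma" and tau: "P tau"
    and mult: "\<And>\<alpha> \<beta>. det \<alpha> = 1 \<Longrightarrow> det \<beta> = 1 \<Longrightarrow> P \<alpha> \<Longrightarrow> P \<beta> \<Longrightarrow> P (\<alpha> ** \<beta>)"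
  shows "P \<gamma>"
proof -
  define Q where "Q \<alpha> \<longleftrightarrow> det \<alpha> = 1 \<and> P \<alpha>" for \<alpha>
  have QM: "Q (\<alpha> ** \<beta>)" if "Q \<alpha>" "Q \<beta>" for \<alpha> \<beta>
    using that mult by (auto simp: Q_def det_mul)
  have Qs: "Q sigma" and Qt: "Q tau"
    using sigma tau by (simp_all add: Q_def det_2)
  define minus_one where "minus_one = sigma ** sigma"
  define sigma_inv where "sigma_inv = sigma ** minus_one"
  have Qm: "Q minus_one" and Qsi: "Q sigma_inv"
    by (simp_all add: minus_one_def sigma_inv_def QM Qs)
  have m_nth: "minus_one $ 1 $ 1 = -1" "minus_one $ 1 $ 2 = 0" "minus_one $ 2 $ 1 = 0" "minus_one $ 2 $ 2 = -1"
    by (simp_all add: minus_one_def mat2_mult_nth)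
  have si_nth: "sigma_inv $ 1 $ 1 = 0" "sigma_inv $ 1 $ 2 = 1" "sigma_inv $ 2 $ 1 = -1" "sigma_inv $ 2 $ 2 = 0"
    by (simp_all add: sigma_inv_def mat2_mult_nth m_nth)
  have Qpos: "Q (upper (int n))" for n
  proof (induction n)
    case 0
    have "upper (int 0) = minus_one ** minus_one"
      by (simp add: mat2_eq_iff mat2_mult_nth m_nth)
    then show ?case using QM Qm by simp
  next
    case (Suc n)
    have "upper (int (Suc n)) = tau ** upper (int n)"
      by (simp add: mat2_eq_iff mat2_mult_nth)
    then show ?case using QM[OF Qt Suc] by simp
  qed
  (* The cube of sigma ** tau is minus the identity, so the inverse of tau is
     - sigma tau sigma tau sigma. *)
  have Qneg: "Q (upper (- int n))" for n
  proof (induction n)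
    case 0
    then show ?case using Qpos[of 0] by simp
  next
    case (Suc n)
    have "upper (- int (Suc n)) =
        minus_one ** (sigma ** (tau ** (sigma ** (tau ** (sigma ** upper (- int n))))))"
      by (simp add: mat2_eq_iff mat2_mult_nth m_nth)
    then show ?case using QM Qm Qs Qt Suc by simp
  qed
  have Qu: "Q (upper n)" for n
    by (cases n rule: int_cases2) (auto intro: Qpos Qneg)
  have "Q \<gamma>" if "det \<gamma> = 1" for \<gamma>
    using that
  proof (induction "nat \<bar>\<gamma> $ 2 $ 1\<bar>" arbitrary: \<gamma> rule: less_induct)
    case less
    define a b c d where abcd: "a = \<gamma> $ 1 $ 1" "b = \<gamma> $ 1 $ 2" "c = \<gamma> $ 2 $ 1" "d = \<gamma> $ 2 $ 2"
    have det: "a * d - b * c = 1" using less.prems by (simp add: det_2 abcd)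
    show ?case
    proof (cases "c = 0")
      case True
      then have "a * d = 1" using det by simp
      then consider "a = 1" "d = 1" | "a = -1" "d = -1"
        by (auto simp: zmult_eq_1_iff)
      then show ?thesis
      proof cases
        case 1
        then have "\<gamma> = upper b" using True by (simp add: mat2_eq_iff abcd)
        then show ?thesis using Qu by simp
      next
        case 2
        then have "\<gamma> = minus_one ** upper (- b)"
          using True by (simp add: mat2_eq_iff mat2_mult_nth m_nth abcd)
        then show ?thesis using QM[OF Qm Qu] by simp
      qed
    next
      case False
      (* One step of the Euclidean algorithm: the lower left entry becomes a mod c. *)
      define \<gamma>' where "\<gamma>' = sigma ** (upper (- (a div c)) ** \<gamma>)"
      have "\<gamma>' $ 2 $ 1 = a mod c"
        by (simp add: \<gamma>'_def mat2_mult_nth minus_div_mult_eq_mod flip: abcd)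
      then have "nat \<bar>\<gamma>' $ 2 $ 1\<bar> < nat \<bar>\<gamma> $ 2 $ 1\<bar>"
        using False by (simp add: abcd(3)[symmetric] abs_mod_less)
      moreover have "det \<gamma>' = 1"
        using less.prems Qu[of "- (a div c)"] Qs by (simp add: \<gamma>'_def det_mul Q_def)
      ultimately have "Q \<gamma>'" by (rule less.hyps)
      moreover have "\<gamma> = upper (a div c) ** (sigma_inv ** \<gamma>')"
        by (simp add: mat2_eq_iff \<gamma>'_def mat2_mult_nth si_nth)
      ultimately show ?thesis using QM Qu Qsi by metis
    qed
  qed
  then show ?thesis using assms(1) by (simp add: Q_def)
qed

section \<open>Linear maps on spaces of functions\<close>

lemma sum_fun_apply: "(\<Sum>i\<in>A. f i) x = (\<Sum>i\<in>A. (f i x :: complex))"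
  by (induction A rule: infinite_finite_induct) auto

lemma fscale_apply [simp]: "(c *\<^sub>F v) x = c * v x"
  by (simp add: fscale_def)

lemma fscale_fscale [simp]: "a *\<^sub>F b *\<^sub>F v = (a * b) *\<^sub>F v"
  by (simp add: fscale_def fun_eq_iff)

lemma linear_on_sum:
  assumes M: "linear_on V M" and V: "fun_space.subspace V"
    and fin: "finite A" and v: "\<And>a. a \<in> A \<Longrightarrow> v a \<in> V"
  shows "M (\<Sum>a\<in>A. c a *\<^sub>F v a) = (\<Sum>a\<in>A. c a *\<^sub>F M (v a))"
  using fin v
proof (induction A rule: finite_induct)
  case empty
  have "M (0 *\<^sub>F 0) = 0 *\<^sub>F M 0"
    using M fun_space.subspace_0[OF V] unfolding linear_on_def by blast
  then show ?case by (simp only: sum.empty fun_space.scale_zero_left)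
next
  case (insert a A)
  have va: "v a \<in> V" and vA: "\<And>b. b \<in> A \<Longrightarrow> v b \<in> V" using insert.prems by simp_all
  have 1: "c a *\<^sub>F v a \<in> V" by (rule fun_space.subspace_scale[OF V va])
  have 2: "(\<Sum>a\<in>A. c a *\<^sub>F v a) \<in> V"
    by (intro fun_space.subspace_sum[OF V] fun_space.subspace_scale[OF V] vA)
  have "M (c a *\<^sub>F v a + (\<Sum>a\<in>A. c a *\<^sub>F v a)) = M (c a *\<^sub>F v a) + M (\<Sum>a\<in>A. c a *\<^sub>F v a)"
    using M 1 2 unfolding linear_on_def by blast
  moreover have "M (c a *\<^sub>F v a) = c a *\<^sub>F M (v a)"
    using M va unfolding linear_on_def by blast
  moreover have "M (\<Sum>a\<in>A. c a *\<^sub>F v a) = (\<Sum>a\<in>A. c a *\<^sub>F M (v a))"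
    by (rule insert.IH) (rule vA)
  ultimately show ?case by (simp only: sum.insert[OF insert.hyps])
qed

lemma linear_on_eq_on_span:
  assumes M: "linear_on (fun_space.span B) M" and N: "linear_on (fun_space.span B) N"
    and eq: "\<And>b. b \<in> B \<Longrightarrow> M b = N b" and v: "v \<in> fun_space.span B"
  shows "M v = N v"
proof -
  obtain F c where F: "finite F" "F \<subseteq> B" and v: "v = (\<Sum>b\<in>F. c b *\<^sub>F b)"
    using v unfolding fun_space.span_explicit by auto
  have "b \<in> fun_space.span B" if "b \<in> F" for b
    using F that by (auto intro: fun_space.span_base)
  then have "M v = (\<Sum>b\<in>F. c b *\<^sub>F M b)" "N v = (\<Sum>b\<in>F. c b *\<^sub>F N b)"
    unfolding v using F M N by (auto intro!: linear_on_sum)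
  moreover have "M b = N b" if "b \<in> F" for b using F that eq by auto
  ultimately show ?thesis by simp
qed

lemma linear_on_compose:
  assumes M: "linear_on V M" and MW: "M ` V \<subseteq> W" and N: "linear_on W N"
  shows "linear_on V (N \<circ> M)"
proof -
  have "N (M (v + w)) = N (M v) + N (M w)" if "v \<in> V" "w \<in> V" for v w
  proof -
    have "N (M (v + w)) = N (M v + M w)"
      using M that unfolding linear_on_def by metis
    also have "\<dots> = N (M v) + N (M w)"
      using N MW that unfolding linear_on_def by blast
    finally show ?thesis .
  qed
  moreover have "N (M (c *\<^sub>F v)) = c *\<^sub>F N (M v)" if "v \<in> V" for c v
  proof -
    have "N (M (c *\<^sub>F v)) = N (c *\<^sub>F M v)"
      using M that unfolding linear_on_def by metis
    also have "\<dots> = c *\<^sub>F N (M v)"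
      using N MW that unfolding linear_on_def by blast
    finally show ?thesis .
  qed
  ultimately show ?thesis unfolding linear_on_def comp_apply by blast
qed

lemma linear_on_subset: "linear_on V M \<Longrightarrow> U \<subseteq> V \<Longrightarrow> linear_on U M"
  unfolding linear_on_def by blast

lemma linear_on_UNIV_expand:
  assumes "linear_on (UNIV :: ('i::finite \<Rightarrow> complex) set) T"
  shows "T f = (\<Sum>i\<in>UNIV. f i *\<^sub>F T (basis_vec i))"
proof -
  have "f = (\<Sum>i\<in>UNIV. f i *\<^sub>F basis_vec i)"
    by (simp add: fun_eq_iff sum_fun_apply basis_vec_def if_distrib cong: if_cong)
  then have "T f = T (\<Sum>i\<in>UNIV. f i *\<^sub>F basis_vec i)" by simp
  also have "\<dots> = (\<Sum>i\<in>UNIV. f i *\<^sub>F T (basis_vec i))"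
    by (rule linear_on_sum[OF assms]) auto
  finally show ?thesis .
qed

section \<open>Projective classes\<close>

lemma carrier_GL: "carrier (GL V) = {M \<in> Bij V. linear_on V M}"
  by (simp add: GL_def)

lemma mult_GL: "M \<in> Bij V \<Longrightarrow> N \<in> Bij V \<Longrightarrow> M \<otimes>\<^bsub>GL V\<^esub> N = compose V M N"
  by (simp add: GL_def BijGroup_def)

lemma scalar_Bij:
  assumes V: "fun_space.subspace V" and c: "c \<noteq> 0"
  shows "(\<lambda>v\<in>V. c *\<^sub>F v) \<in> Bij V"
proof -
  have "bij_betw (\<lambda>v. c *\<^sub>F v) V V"
    by (rule bij_betw_byWitness[where f' = "\<lambda>v. inverse c *\<^sub>F v"])
      (use c in \<open>auto intro: fun_space.subspace_scale[OF V]\<close>)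
  then show ?thesis by (simp add: Bij_def)
qed

lemma scalar_mult_GL:
  assumes "fun_space.subspace V" "c \<noteq> 0" "M \<in> Bij V"
  shows "(\<lambda>v\<in>V. c *\<^sub>F v) \<otimes>\<^bsub>GL V\<^esub> M = (\<lambda>v\<in>V. c *\<^sub>F M v)"
proof -
  have "(\<lambda>v\<in>V. c *\<^sub>F v) \<otimes>\<^bsub>GL V\<^esub> M = compose V (\<lambda>v\<in>V. c *\<^sub>F v) M"
    using assms by (intro mult_GL scalar_Bij)
  also have "\<dots> = (\<lambda>v\<in>V. c *\<^sub>F M v)"
    using Bij_imp_funcset[OF assms(3)] by (auto simp: compose_def fun_eq_iff)
  finally show ?thesis .
qed

lemma proj_class_eq:
  assumes V: "fun_space.subspace V" and M: "M \<in> Bij V"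
  shows "proj_class V M = {\<lambda>v\<in>V. c *\<^sub>F M v | c. c \<noteq> 0}"
proof (intro equalityI subsetI)
  fix N assume "N \<in> proj_class V M"
  then obtain c where "c \<noteq> 0" "N = (\<lambda>v\<in>V. c *\<^sub>F v) \<otimes>\<^bsub>GL V\<^esub> M"
    unfolding proj_class_def r_coset_def scalars_def by blast
  then show "N \<in> {\<lambda>v\<in>V. c *\<^sub>F M v | c. c \<noteq> 0}"
    using scalar_mult_GL[OF V _ M] by blast
next
  fix N assume "N \<in> {\<lambda>v\<in>V. c *\<^sub>F M v | c. c \<noteq> 0}"
  then obtain c where c: "c \<noteq> 0" "N = (\<lambda>v\<in>V. c *\<^sub>F M v)" by blast
  have "N = (\<lambda>v\<in>V. c *\<^sub>F v) \<otimes>\<^bsub>GL V\<^esub> M"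
    unfolding c(2) by (rule scalar_mult_GL[OF V c(1) M, symmetric])
  with c(1) show "N \<in> proj_class V M"
    unfolding proj_class_def r_coset_def scalars_def by blast
qed

lemma proj_class_self:
  assumes "fun_space.subspace V" "M \<in> Bij V"
  shows "M \<in> proj_class V M"
proof -
  have "M = (\<lambda>v\<in>V. 1 *\<^sub>F M v)"
    using Bij_imp_extensional[OF assms(2)] by (auto simp: fun_eq_iff extensional_def)
  then show ?thesis
    unfolding proj_class_eq[OF assms] by (intro CollectI exI[of _ 1] conjI one_neq_zero)
qed

lemma carrier_PGL: "carrier (PGL V) = proj_class V ` carrier (GL V)"
proof -
  have "proj_class V = (\<lambda>M. scalars V #>\<^bsub>GL V\<^esub> M)"
    by (rule ext) (simp only: proj_class_def)
  then show ?thesis by (simp only: PGL_def carrier_FactGroup)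
qed

text \<open>Any member of a projective class may serve as its representative. This allows the members of a class
to be chosen freely later, without a cocycle of scalars.\<close>

lemma PGL_eq_proj_class:
  assumes V: "fun_space.subspace V" and C: "C \<in> carrier (PGL V)" and M: "M \<in> C"
  shows "M \<in> carrier (GL V)" "C = proj_class V M"
proof -
  obtain N where N: "N \<in> carrier (GL V)" and C: "C = proj_class V N"
    using C unfolding carrier_PGL by blast
  have NB: "N \<in> Bij V" and NL: "linear_on V N" using N by (auto simp: carrier_GL)
  obtain c where c: "c \<noteq> 0" and Meq: "M = (\<lambda>v\<in>V. c *\<^sub>F N v)"
    using M unfolding C proj_class_eq[OF V NB] by blast
  have "M = (\<lambda>v\<in>V. c *\<^sub>F v) \<otimes>\<^bsub>GL V\<^esub> N"
    by (simp only: Meq scalar_mult_GL[OF V c NB])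
  then have MB: "M \<in> Bij V"
    by (simp add: mult_GL scalar_Bij[OF V c] NB compose_Bij)
  have "linear_on V M"
    using NL fun_space.subspace_add[OF V] fun_space.subspace_scale[OF V] unfolding Meq linear_on_def
    by (auto simp: fun_space.scale_right_distrib mult.commute)
  with MB show "M \<in> carrier (GL V)" by (simp add: carrier_GL)
  have "(\<lambda>v\<in>V. d *\<^sub>F N v) = (\<lambda>v\<in>V. (d / c) *\<^sub>F M v)" for d
    using c by (auto simp: Meq fun_eq_iff)
  moreover have "(\<lambda>v\<in>V. d *\<^sub>F M v) = (\<lambda>v\<in>V. (d * c) *\<^sub>F N v)" for d
    by (auto simp: Meq fun_eq_iff)
  moreover have "d / c \<noteq> 0" "d * c \<noteq> 0" if "d \<noteq> 0" for d
    using c that by simp_all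
  ultimately show "C = proj_class V M"
    unfolding C proj_class_eq[OF V NB] proj_class_eq[OF V MB] by blast
qed

text \<open>The group operation of \<open>GL V\<close> has an unspecified value on an argument that is not a bijection,
so such an \<open>M\<close> has at most one element in its class. A genuine element of \<open>PGL V\<close> has at least
two as soon as \<open>V\<close> is nonzero, since multiplying by \<open>1\<close> and by \<open>2\<close> gives different maps. So
the bijectivity of the two matrices that define the genus one representation comes for free, without
an inversion of the S-matrix.\<close>

lemma proj_class_in_PGL_imp_GL:
  assumes V: "fun_space.subspace V" and v: "v \<in> V" "v \<noteq> 0"
    and C: "proj_class V M \<in> carrier (PGL V)"
  shows "M \<in> carrier (GL V)" "M \<in> proj_class V M"
proof -
  obtain N where eq: "proj_class V M = proj_class V N" and "N \<in> carrier (GL V)"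
    using C unfolding carrier_PGL by (rule imageE)
  then have N: "N \<in> Bij V" by (simp add: carrier_GL)
  have "M \<in> Bij V"
  proof (rule ccontr)
    assume "M \<notin> Bij V"
    then have "proj_class V M \<subseteq> {undefined}"
      unfolding proj_class_def r_coset_def scalars_def
      by (auto simp: GL_def BijGroup_def scalar_Bij[OF V])
    then have all: "x = y" if "x \<in> proj_class V N" "y \<in> proj_class V N" for x y
      using that unfolding eq by blast
    have mem: "(\<lambda>v\<in>V. c *\<^sub>F N v) \<in> proj_class V N" if "c \<noteq> 0" for c
      using that unfolding proj_class_eq[OF V N] by blast
    have restrict_eq: "(\<lambda>v\<in>V. 1 *\<^sub>F N v) = (\<lambda>v\<in>V. 2 *\<^sub>F N v)"
      by (intro all mem) simp_all
    have "v \<in> N ` V" using N v(1) by (simp add: Bij_def bij_betw_def)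
    then obtain w where w: "w \<in> V" "N w = v" by blast
    have "1 *\<^sub>F v = 2 *\<^sub>F v"
      using fun_cong[OF restrict_eq, of w] by (simp only: restrict_apply' w)
    then show False using v(2) by (auto simp: fun_eq_iff)
  qed
  from proj_class_self[OF V this] show "M \<in> proj_class V M" .
  from PGL_eq_proj_class(1)[OF V C this] show "M \<in> carrier (GL V)" .
qed

lemma mult_PGL_mem:
  assumes V: "fun_space.subspace V" and "C \<in> carrier (PGL V)" "D \<in> carrier (PGL V)" "M \<in> C" "N \<in> D"
  shows "compose V M N \<in> C \<otimes>\<^bsub>PGL V\<^esub> D"
proof -
  have "M \<in> Bij V" "N \<in> Bij V"
    using assms PGL_eq_proj_class(1)[OF V] by (auto simp: carrier_GL)
  then have "compose V M N = M \<otimes>\<^bsub>GL V\<^esub> N" by (simp add: mult_GL)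
  moreover have "M \<otimes>\<^bsub>GL V\<^esub> N \<in> C <#>\<^bsub>GL V\<^esub> D"
    using assms unfolding set_mult_def by blast
  ultimately show ?thesis by (simp add: PGL_def)
qed

section \<open>Intertwining operators of the Heisenberg representation\<close>

lemma heis_nth [simp]: "heis x y z $ 2 $ 3 = x" "heis x y z $ 1 $ 2 = y" "heis x y z $ 1 $ 3 = z"
  by (simp_all add: heis_def)

lemma heis_mem: "heis x y z \<in> carrier Heisenberg"
  by (auto simp: Heisenberg_def)

lemma heis_act_mem: "heis_act \<alpha> h \<in> carrier Heisenberg"
  by (auto simp: heis_act_def Let_def heis_mem)

lemma heis_act_mult:
  "heis_act \<alpha> (heis_act \<beta> h) = heis_act (\<alpha> ** \<beta>) h"
proof -
  have "a * (b * x + c * y) + d * (e * x + f * y) = (a * b + d * e) * x + (a * c + d * f) * y"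
    for a b c d e f x y :: 'a
    by (simp add: algebra_simps)
  then show ?thesis by (simp add: heis_act_def Let_def mat2_mult_nth)
qed

lemma weil_mult:
  assumes "W \<in> weil \<phi> \<alpha>" "W' \<in> weil \<phi> \<beta>"
  shows "W \<circ> W' \<in> weil \<phi> (\<alpha> ** \<beta>)"
proof -
  have "W \<circ> W' \<in> carrier (GL L2)"
    using assms linear_on_compose[of UNIV W' UNIV W] by (auto simp: weil_def carrier_GL Bij_def intro: bij_comp)
  moreover have "(W \<circ> W') \<circ> heis_rep \<phi> h = heis_rep \<phi> (heis_act (\<alpha> ** \<beta>) h) \<circ> (W \<circ> W')"
    if h: "h \<in> carrier Heisenberg" for h
  proof -
    have W: "W \<circ> heis_rep \<phi> (heis_act \<beta> h) = heis_rep \<phi> (heis_act (\<alpha> ** \<beta>) h) \<circ> W"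
      using assms(1) heis_act_mem[of \<beta> h] by (simp add: weil_def flip: heis_act_mult)
    have "(W \<circ> W') \<circ> heis_rep \<phi> h = W \<circ> (heis_rep \<phi> (heis_act \<beta> h) \<circ> W')"
      using assms(2) h by (simp add: weil_def comp_assoc)
    also have "\<dots> = (W \<circ> heis_rep \<phi> (heis_act \<beta> h)) \<circ> W'" by (simp only: comp_assoc)
    also have "\<dots> = heis_rep \<phi> (heis_act (\<alpha> ** \<beta>) h) \<circ> (W \<circ> W')"
      by (simp only: W comp_assoc)
    finally show ?thesis .
  qed
  ultimately show ?thesis by (simp add: weil_def)
qed

text \<open>Schur's lemma for the Heisenberg representation, in a form that needs no theory of irreducibility.
The function \<open>basis_vec 0\<close> is, up to a scalar, the only common fixed vector of the modulations
\<open>heis x 0 0\<close>, so \<open>T\<close> multiplies it by a scalar; the translations \<open>heis 0 y 0\<close> carry it to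
every other basis vector and commute with \<open>T\<close>, so the scalar is the same for all of them.\<close>

lemma heis_rep_commutant_scalar:
  fixes T :: "('p::prime_card mod_ring \<Rightarrow> complex) \<Rightarrow> ('p mod_ring \<Rightarrow> complex)"
  assumes T: "linear_on UNIV T"
    and comm: "\<And>x y z. T \<circ> heis_rep std_char (heis x y z) = heis_rep std_char (heis x y z) \<circ> T"
  shows "\<exists>c. \<forall>f. T f = c *\<^sub>F f"
proof -
  let ?g = "T (basis_vec 0)"
  have rep: "T (heis_rep std_char (heis x y z) f) = heis_rep std_char (heis x y z) (T f)" for x y z f
    using comm[of x y z] by (simp add: fun_eq_iff)
  (* The modulation by 1 fixes basis_vec 0, hence also ?g, but multiplies ?g a by std_char (- a). *)
  have "?g a = 0" if "a \<noteq> 0" for a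
  proof -
    have "heis_rep std_char (heis 1 0 0) (basis_vec 0) = (basis_vec 0 :: 'p mod_ring \<Rightarrow> complex)"
      by (auto simp: heis_rep_def basis_vec_def fun_eq_iff)
    then have "?g a = T (heis_rep std_char (heis 1 0 0) (basis_vec 0)) a" by simp
    also have "\<dots> = std_char (- a) * ?g a" by (simp add: rep) (simp add: heis_rep_def)
    finally have "?g a = std_char (- a) * ?g a" .
    moreover have "std_char (- a) \<noteq> 1" using that by (simp add: std_char_eq_1_iff)
    ultimately show ?thesis by simp
  qed
  then have g: "?g = ?g 0 *\<^sub>F basis_vec 0"
    by (auto simp: basis_vec_def fun_eq_iff)
  have delta: "T (basis_vec y) = ?g 0 *\<^sub>F basis_vec y" for y
  proof -
    have "basis_vec y = heis_rep std_char (heis 0 y 0) (basis_vec 0)"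
      by (auto simp: heis_rep_def basis_vec_def fun_eq_iff)
    then have "T (basis_vec y) = heis_rep std_char (heis 0 y 0) ?g" by (simp only: rep)
    also have "\<dots> = heis_rep std_char (heis 0 y 0) (?g 0 *\<^sub>F basis_vec 0)"
      using g by simp
    also have "\<dots> = ?g 0 *\<^sub>F basis_vec y"
      by (auto simp: heis_rep_def basis_vec_def fun_eq_iff)
    finally show ?thesis .
  qed
  define c where "c = ?g 0"
  have "T f = c *\<^sub>F f" for f
  proof -
    have "T f = (\<Sum>i\<in>UNIV. f i *\<^sub>F c *\<^sub>F basis_vec i)"
      unfolding linear_on_UNIV_expand[OF T, of f] delta [folded c_def] ..
    also have "\<dots> = c *\<^sub>F f"
      by (simp add: fun_eq_iff sum_fun_apply basis_vec_def if_distrib cong: if_cong)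
    finally show ?thesis .
  qed
  then show ?thesis by blast
qed

lemma weilD:
  fixes W :: "('p::prime_card mod_ring \<Rightarrow> complex) \<Rightarrow> _"
  assumes "W \<in> weil \<phi> \<alpha>"
  shows "bij W" "linear_on UNIV W" "W (f + g) = W f + W g" "W (c *\<^sub>F f) = c *\<^sub>F W f"
    "W (heis_rep \<phi> (heis x y z) f) = heis_rep \<phi> (heis_act \<alpha> (heis x y z)) (W f)"
proof -
  have W: "W \<in> carrier (GL L2)"
    and int: "W \<circ> heis_rep \<phi> (heis x y z) = heis_rep \<phi> (heis_act \<alpha> (heis x y z)) \<circ> W"
    using assms heis_mem unfolding weil_def by blast+
  from W show "bij W" and lin: "linear_on UNIV W" by (simp_all add: carrier_GL Bij_def)
  from lin show "W (f + g) = W f + W g" "W (c *\<^sub>F f) = c *\<^sub>F W f"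
    unfolding linear_on_def by blast+
  from fun_cong[OF int, of f]
  show "W (heis_rep \<phi> (heis x y z) f) = heis_rep \<phi> (heis_act \<alpha> (heis x y z)) (W f)"
    by (simp only: comp_apply)
qed

lemma weil_scale:
  fixes W :: "('p::prime_card mod_ring \<Rightarrow> complex) \<Rightarrow> _"
  assumes W: "W \<in> weil \<phi> \<alpha>" and c: "c \<noteq> 0"
  shows "(\<lambda>f. c *\<^sub>F W f) \<in> weil \<phi> \<alpha>"
proof -
  have scale: "bij (\<lambda>f :: 'p mod_ring \<Rightarrow> complex. c *\<^sub>F f)"
    using scalar_Bij[of UNIV c] c by (simp add: Bij_def restrict_UNIV)
  have "bij (\<lambda>f. c *\<^sub>F W f)"
    using bij_comp[OF weilD(1)[OF W] scale] by (simp only: comp_def)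
  moreover have "linear_on UNIV (\<lambda>f. c *\<^sub>F W f)"
    unfolding linear_on_def weilD(3,4)[OF W] fun_space.scale_right_distrib fscale_fscale
    by (simp only: mult.commute ball_simps simp_thms)
  moreover have "(\<lambda>f. c *\<^sub>F W f) \<circ> heis_rep \<phi> h = heis_rep \<phi> (heis_act \<alpha> h) \<circ> (\<lambda>f. c *\<^sub>F W f)"
    if mem: "h \<in> carrier Heisenberg" for h
  proof
    fix f
    obtain x y z where h: "h = heis x y z" using mem by (auto simp: Heisenberg_def)
    have "heis_rep \<phi> k (c *\<^sub>F g) = c *\<^sub>F heis_rep \<phi> k g" for k g
      by (rule ext) (simp add: heis_rep_def Let_def)
    then show "((\<lambda>f. c *\<^sub>F W f) \<circ> heis_rep \<phi> h) f = (heis_rep \<phi> (heis_act \<alpha> h) \<circ> (\<lambda>f. c *\<^sub>F W f)) f"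
      by (simp only: comp_apply h weilD(5)[OF W])
  qed
  ultimately show ?thesis by (simp add: weil_def carrier_GL Bij_def)
qed

text \<open>Composing one intertwiner with the inverse of another gives an operator that commutes with the
Heisenberg group.\<close>

lemma weil_unique:
  fixes W :: "('p::prime_card mod_ring \<Rightarrow> complex) \<Rightarrow> _"
  assumes W: "W \<in> weil std_char \<alpha>" and W': "W' \<in> weil std_char \<alpha>"
  obtains c where "c \<noteq> 0" "W' = (\<lambda>f. c *\<^sub>F W f)"
proof -
  define T where "T = inv_into UNIV W \<circ> W'"
  have WT: "W (T f) = W' f" for f
    using weilD(1)[OF W] by (simp add: T_def bij_is_surj surj_f_inv_f)
  have inj: "f = g" if "W f = W g" for f g
    using weilD(1)[OF W] that by (simp add: bij_is_inj inj_eq)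
  have "T (f + g) = T f + T g" for f g
    by (rule inj) (simp only: WT weilD(3)[OF W] weilD(3)[OF W'])
  moreover have "T (c *\<^sub>F f) = c *\<^sub>F T f" for c f
    by (rule inj) (simp only: WT weilD(4)[OF W] weilD(4)[OF W'])
  ultimately have "linear_on UNIV T" unfolding linear_on_def by blast
  moreover have "T \<circ> heis_rep std_char (heis x y z) = heis_rep std_char (heis x y z) \<circ> T" for x y z
    unfolding comp_def by (rule ext, rule inj) (simp only: WT weilD(5)[OF W] weilD(5)[OF W'])
  ultimately obtain c where c: "\<And>f. T f = c *\<^sub>F f"
    using heis_rep_commutant_scalar by blast
  have W'eq: "W' f = c *\<^sub>F W f" for f
    by (simp only: WT [symmetric] c weilD(4)[OF W])
  have "c \<noteq> 0"
  proof
    assume "c = 0"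
    then have "W' (basis_vec 0) = W' 0" by (simp only: W'eq fun_space.scale_zero_left)
    then have "basis_vec 0 = (0 :: 'p mod_ring \<Rightarrow> complex)"
      using weilD(1)[OF W'] by (simp add: bij_is_inj inj_eq)
    from fun_cong[OF this, of 0] show False by (simp add: basis_vec_def)
  qed
  moreover have "W' = (\<lambda>f. c *\<^sub>F W f)" by (rule ext) (rule W'eq)
  ultimately show ?thesis by (rule that)
qed

lemma weil_eq_multiples:
  fixes W :: "('p::prime_card mod_ring \<Rightarrow> complex) \<Rightarrow> _"
  assumes W: "W \<in> weil std_char \<alpha>"
  shows "weil std_char \<alpha> = {\<lambda>f. c *\<^sub>F W f | c. c \<noteq> 0}"
proof (intro equalityI subsetI)
  fix W' assume "W' \<in> weil std_char \<alpha>"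
  then obtain c where "c \<noteq> 0" "W' = (\<lambda>f. c *\<^sub>F W f)" by (rule weil_unique[OF W])
  then show "W' \<in> {\<lambda>f. c *\<^sub>F W f | c. c \<noteq> 0}" by blast
next
  fix W' assume "W' \<in> {\<lambda>f. c *\<^sub>F W f | c. c \<noteq> 0}"
  then obtain c where "c \<noteq> 0" "W' = (\<lambda>f. c *\<^sub>F W f)" by blast
  then show "W' \<in> weil std_char \<alpha>" using weil_scale[OF W] by simp
qed

section \<open>The Fourier transform and the quadratic chirp\<close>

text \<open>The scalar \<open>1 / sqrt p\<close> does not affect the projective class. It is chosen so that the transform
agrees with the S-matrix of the modular category exactly.\<close>

definition fourier :: "('p::prime_card mod_ring \<Rightarrow> complex) \<Rightarrow> 'p mod_ring \<Rightarrow> complex"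
  where "fourier f = (\<lambda>j. 1 / of_real (sqrt CARD('p)) * (\<Sum>k\<in>UNIV. std_char (j * k) * f k))"

definition chirp :: "('p::prime_card mod_ring \<Rightarrow> complex) \<Rightarrow> 'p mod_ring \<Rightarrow> complex"
  where "chirp f = (\<lambda>j. std_char (- (j ^ 2 / 2)) * f j)"

lemma of_real_sqrt_sq: "complex_of_real (sqrt (real n)) * complex_of_real (sqrt (real n)) = of_nat n"
  by (simp flip: of_real_mult)

lemma fourier_fourier: "fourier (fourier f) = (\<lambda>j. f (- j :: 'p::prime_card mod_ring))"
proof
  fix j :: "'p mod_ring"
  let ?s = "1 / complex_of_real (sqrt CARD('p))"
  have "fourier (fourier f) j =
      ?s * (\<Sum>k\<in>UNIV. std_char (j * k) * (?s * (\<Sum>l\<in>UNIV. std_char (k * l) * f l)))"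
    by (simp add: fourier_def)
  also have "\<dots> = (?s * ?s) * (\<Sum>k\<in>UNIV. \<Sum>l\<in>UNIV. std_char (k * (j + l)) * f l)"
    by (simp add: sum_distrib_left distrib_left std_char_add mult_ac)
  also have "(\<Sum>k\<in>UNIV. \<Sum>l\<in>UNIV. std_char (k * (j + l)) * f l) =
      (\<Sum>l\<in>UNIV. (\<Sum>k\<in>UNIV. std_char (k * (j + l))) * f l)"
    by (subst sum.swap) (simp add: sum_distrib_right)
  also have "\<dots> = (\<Sum>l\<in>UNIV. if l = - j then of_nat CARD('p) * f l else 0)"
    by (rule sum.cong) (auto simp: std_char_orthogonality add_eq_0_iff)
  also have "\<dots> = of_nat CARD('p) * f (- j)"
    by simp
  also have "?s * ?s * (of_nat CARD('p) * f (- j)) = f (- j)"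
    by (simp add: of_real_sqrt_sq)
  finally show "fourier (fourier f) j = f (- j)" .
qed

lemma bij_fourier: "bij (fourier :: ('p::prime_card mod_ring \<Rightarrow> complex) \<Rightarrow> _)"
  by (rule o_bij[of "fourier \<circ> fourier \<circ> fourier"]) (simp_all add: fun_eq_iff fourier_fourier)

lemma linear_on_fourier: "linear_on U fourier"
  by (auto simp: linear_on_def fourier_def fun_eq_iff distrib_left sum.distrib sum_distrib_left mult_ac)

text \<open>In characteristic two division by \<open>2\<close> gives \<open>0\<close>, and the two halves of \<open>x * y\<close> would not add
up to \<open>x * y\<close>; this is why \<open>p\<close> has to be odd.\<close>

lemma heis_act_sigma:
  assumes "CARD('p::prime_card) \<ge> 3"
  shows "heis_act (reduce_mod sigma) (heis x y z) = heis (- y) x (z - x * y :: 'p mod_ring)"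
proof -
  have "x * y / 2 + x * y / 2 = 2 * (x * y) / 2"
    by (simp only: mult_2 add_divide_distrib)
  also have "\<dots> = x * y" using two_neq_0_mod_ring[OF assms] by simp
  finally have halves: "x * y / 2 + x * y / 2 = x * y" .
  have "z - x * y / 2 + - y * x / 2 = z - (x * y / 2 + x * y / 2)"
    by (simp add: mult.commute)
  then have z: "z - x * y / 2 + - y * x / 2 = z - x * y" by (simp only: halves)
  have "heis_act (reduce_mod sigma) (heis x y z) = heis (- y) x (z - x * y / 2 + - y * x / 2)"
    by (simp add: heis_act_def Let_def reduce_mod_def)
  then show ?thesis by (simp only: z)
qed

lemma heis_act_tau:
  "heis_act (reduce_mod tau) (heis x y z) = heis (x + y) y (z + y ^ 2 / 2 :: 'p::prime_card mod_ring)"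
  by (simp add: heis_act_def Let_def reduce_mod_def power2_eq_square distrib_right add_divide_distrib)

lemma weilI:
  fixes W :: "('p::prime_card mod_ring \<Rightarrow> complex) \<Rightarrow> _"
  assumes "bij W" "linear_on UNIV W"
    and "\<And>x y z f a. W (heis_rep \<phi> (heis x y z) f) a = heis_rep \<phi> (heis_act \<alpha> (heis x y z)) (W f) a"
  shows "W \<in> weil \<phi> \<alpha>"
proof -
  have "W \<circ> heis_rep \<phi> h = heis_rep \<phi> (heis_act \<alpha> h) \<circ> W" if mem: "h \<in> carrier Heisenberg" for h
  proof -
    obtain x y z where "h = heis x y z" using mem by (auto simp: Heisenberg_def)
    then show ?thesis using assms(3)[of x y z] unfolding comp_def by blast
  qed
  then show ?thesis using assms(1,2) by (simp add: weil_def carrier_GL Bij_def)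
qed

lemma heis_rep_heis: "heis_rep \<phi> (heis x y z) f a = \<phi> (- x * a + z) * f (a - y)"
  by (simp add: heis_rep_def Let_def)

text \<open>The Fourier transform turns translations into modulations, and conversely, which is the action of
\<open>sigma\<close> on the Heisenberg group.\<close>

lemma fourier_in_weil:
  assumes "CARD('p::prime_card) \<ge> 3"
  shows "fourier \<in> weil std_char (reduce_mod sigma :: 'p mod_ring ^ 2 ^ 2)"
proof (rule weilI[OF bij_fourier linear_on_fourier])
  fix x y z j :: "'p mod_ring" and f
  let ?s = "1 / complex_of_real (sqrt CARD('p))"
  let ?u = "std_char (y * j + (z - x * y))"
  have exponent: "j * (m + y) + (- x * (m + y) + z) = (y * j + (z - x * y)) + (j - x) * m" for m
    by (simp add: algebra_simps)
  have "fourier (heis_rep std_char (heis x y z) f) j =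
      ?s * (\<Sum>k\<in>UNIV. std_char (j * k) * (std_char (- x * k + z) * f (k - y)))"
    by (simp only: fourier_def heis_rep_heis)
  also have "(\<Sum>k\<in>UNIV. std_char (j * k) * (std_char (- x * k + z) * f (k - y))) =
      (\<Sum>m\<in>UNIV. std_char (j * (m + y)) * (std_char (- x * (m + y) + z) * f m))"
    by (rule sum.reindex_bij_witness[of _ "\<lambda>m. m + y" "\<lambda>k. k - y"]) auto
  also have "\<dots> = (\<Sum>m\<in>UNIV. ?u * (std_char ((j - x) * m) * f m))"
    by (simp only: mult.assoc [symmetric] std_char_add [symmetric] exponent)
  also have "?s * \<dots> = ?u * fourier f (j - x)"
    unfolding sum_distrib_left [symmetric] fourier_def by (rule mult.left_commute)
  also have "\<dots> = heis_rep std_char (heis_act (reduce_mod sigma) (heis x y z)) (fourier f) j"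
    by (simp only: heis_act_sigma[OF assms] heis_rep_heis minus_minus)
  finally show "fourier (heis_rep std_char (heis x y z) f) j =
    heis_rep std_char (heis_act (reduce_mod sigma) (heis x y z)) (fourier f) j" .
qed

lemma chirp_exponent:
  fixes c :: "'a::comm_ring_1"
  assumes "c + c = 1"
  shows "- (j ^ 2 * c) + (- x * j + z) =
    (- (x + y) * j + (z + y ^ 2 * c)) + (- ((j - y) ^ 2 * c))"
proof -
  have "(- (x + y) * j + (z + y ^ 2 * c)) + (- ((j - y) ^ 2 * c)) =
      (- (j ^ 2 * c) + (- x * j + z)) + (y * j * (c + c) - y * j)"
    by (simp add: algebra_simps power2_eq_square)
  then show ?thesis by (simp only: assms mult_1_right diff_self add_0_right)
qed

text \<open>Multiplication by a quadratic phase commutes with modulations and turns a translation by \<open>y\<close> into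
the translation composed with a modulation of frequency \<open>y\<close>. The identity of phases is the
preceding lemma at \<open>c = 1/2\<close>.\<close>

lemma chirp_in_weil:
  assumes "CARD('p::prime_card) \<ge> 3"
  shows "chirp \<in> weil std_char (reduce_mod tau :: 'p mod_ring ^ 2 ^ 2)"
proof (rule weilI)
  show "bij (chirp :: ('p mod_ring \<Rightarrow> complex) \<Rightarrow> _)"
  proof (rule o_bij)
    show "(\<lambda>f j. std_char (j ^ 2 / 2) * f j) \<circ> chirp = id" "chirp \<circ> (\<lambda>f j. std_char (j ^ 2 / 2) * f j) = id"
      by (simp_all add: fun_eq_iff chirp_def mult.assoc [symmetric] std_char_add [symmetric])
  qed
  show "linear_on UNIV (chirp :: ('p mod_ring \<Rightarrow> complex) \<Rightarrow> _)"
    by (auto simp: linear_on_def chirp_def fun_eq_iff algebra_simps)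
next
  fix x y z j :: "'p mod_ring" and f
  have "(1 / 2 :: 'p mod_ring) + 1 / 2 = (1 + 1) / 2"
    by (simp only: add_divide_distrib)
  also have "\<dots> = 1" using two_neq_0_mod_ring[OF assms] by simp
  finally have "(1 / 2 :: 'p mod_ring) + 1 / 2 = 1" .
  from chirp_exponent[OF this, of j x z y]
  have exponent: "- (j ^ 2 / 2) + (- x * j + z) =
      (- (x + y) * j + (z + y ^ 2 / 2)) + (- ((j - y) ^ 2 / 2))"
    by simp
  show "chirp (heis_rep std_char (heis x y z) f) j =
      heis_rep std_char (heis_act (reduce_mod tau) (heis x y z)) (chirp f) j"
    by (simp only: heis_act_tau heis_rep_heis chirp_def mult.assoc [symmetric] std_char_add [symmetric] exponent)
qed

section \<open>Even functions\<close>

lemma basis_vec_reflect: "basis_vec a (- x) = basis_vec (- a) (x :: 'a::group_add)"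
proof -
  have "- x = a \<longleftrightarrow> x = - a" by auto
  then show ?thesis by (simp only: basis_vec_def)
qed

lemma basis_pair_reflect:
  "(basis_vec a + basis_vec (- a)) (- x) = (basis_vec a + basis_vec (- a)) (x :: 'a::group_add)"
  by (simp only: plus_fun_apply basis_vec_reflect minus_minus add.commute)

text \<open>The classes \<open>0, \<plusminus>1, \<dots>, \<plusminus>r\<close> are distinct and exhaust \<open>\<int>/p\<int>\<close> because \<open>2 r + 1 = p\<close>, so an even
function is determined by its values at \<open>0, \<dots>, r\<close>, and both sides agree there. Besides describing
\<open>E_even\<close>, this recognises the images under the identification with \<open>H2\<close> of vectors given by
coordinates.\<close>

lemma even_expansion:
  fixes f :: "'p::prime_card mod_ring \<Rightarrow> complex"
  assumes p: "CARD('p) \<ge> 3" and even: "\<And>x. f (- x) = f x"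
  shows "f = f 0 *\<^sub>F basis_vec 0 +
    (\<Sum>k = 1..half CARD('p). f (of_nat k) *\<^sub>F (basis_vec (of_nat k) + basis_vec (- of_nat k)))"
    (is "f = ?g")
proof
  fix x :: "'p mod_ring"
  let ?r = "half CARD('p)"
  have "odd CARD('p)" using prime_odd_nat[OF prime_card[where 'a = 'p]] p by simp
  then have r: "2 * ?r + 1 = CARD('p)" unfolding half_def by presburger
  have g_even: "?g (- y) = ?g y" for y
    by (simp only: plus_fun_apply[of "_ *\<^sub>F _"] sum_fun_apply fscale_apply basis_pair_reflect
        basis_vec_reflect minus_zero)
  have small: "f (of_nat m) = ?g (of_nat m)" if m: "m \<le> ?r" for m
  proof -
    have eq0: "(of_nat n :: 'p mod_ring) \<noteq> 0" if "n \<noteq> 0" "n < CARD('p)" for n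
      using of_nat_0_mod_ring_dvd[of n, where 'a = 'p] nat_dvd_not_less[of n "CARD('p)"] that by auto
    have inj: "(of_nat m :: 'p mod_ring) = of_nat k \<longleftrightarrow> m = k" if k: "k \<le> ?r" for k
    proof (cases m k rule: linorder_cases)
      case less
      have "k - m \<noteq> 0" "k - m < CARD('p)" using less k r by linarith+
      then have "(of_nat (k - m) :: 'p mod_ring) \<noteq> 0" by (rule eq0)
      then show ?thesis using less by (auto simp: of_nat_diff)
    next
      case greater
      have "m - k \<noteq> 0" "m - k < CARD('p)" using greater m r by linarith+
      then have "(of_nat (m - k) :: 'p mod_ring) \<noteq> 0" by (rule eq0)
      then show ?thesis using greater by (auto simp: of_nat_diff)
    qed simp
    have neg: "(of_nat m :: 'p mod_ring) \<noteq> - of_nat k" if "1 \<le> k" "k \<le> ?r" for k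
    proof -
      have "m + k \<noteq> 0" "m + k < CARD('p)" using that m r by linarith+
      then have "(of_nat (m + k) :: 'p mod_ring) \<noteq> 0" by (rule eq0)
      then show ?thesis by (simp add: eq_neg_iff_add_eq_0)
    qed
    have "(\<Sum>k = 1..?r. f (of_nat k) *\<^sub>F (basis_vec (of_nat k) + basis_vec (- of_nat k))) (of_nat m :: 'p mod_ring) =
        (\<Sum>k = 1..?r. if k = m then f (of_nat m) else 0)"
      unfolding sum_fun_apply
    proof (rule sum.cong[OF refl])
      fix k assume k: "k \<in> {1..?r}"
      then have at_k: "basis_vec (of_nat k) (of_nat m :: 'p mod_ring) = (if k = m then 1 else 0)"
        using inj[of k] by (auto simp: basis_vec_def)
      have at_minus_k: "basis_vec (- of_nat k) (of_nat m :: 'p mod_ring) = 0"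
        using neg[of k] k by (simp add: basis_vec_def)
      show "(f (of_nat k) *\<^sub>F (basis_vec (of_nat k) + basis_vec (- of_nat k))) (of_nat m :: 'p mod_ring) =
          (if k = m then f (of_nat m) else 0)"
        by (simp only: fscale_apply plus_fun_apply at_k at_minus_k) simp
    qed
    moreover have "basis_vec 0 (of_nat m :: 'p mod_ring) = (if m = 0 then 1 else 0)"
      using inj[of 0] by (auto simp: basis_vec_def)
    ultimately show ?thesis using m by (cases "m = 0") auto
  qed
  obtain i where i: "i < CARD('p)" "x = of_nat i" using surj_of_nat_mod_ring by blast
  show "f x = ?g x"
  proof (cases "i \<le> ?r")
    case True
    show ?thesis unfolding i(2) by (rule small[OF True])
  next
    case False
    then have "CARD('p) - i \<le> ?r" using r by linarith
    have x: "x = - of_nat (CARD('p) - i)" using i by (simp add: of_nat_diff)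
    have "f x = f (of_nat (CARD('p) - i))" by (simp only: x even)
    also have "\<dots> = ?g (of_nat (CARD('p) - i))" by (rule small) fact
    also have "\<dots> = ?g x" unfolding x by (rule g_even [symmetric])
    finally show ?thesis .
  qed
qed

lemma of_nat_card_diff:
  "k \<le> CARD('p) \<Longrightarrow> (of_nat (CARD('p) - k) :: 'p::prime_card mod_ring) = - of_nat k"
  by (simp add: of_nat_diff)

lemma half_le: "half n \<le> n" by (simp add: half_def)

lemma E_even_eq:
  assumes p: "CARD('p::prime_card) \<ge> 3"
  shows "E_even = {f :: 'p mod_ring \<Rightarrow> complex. \<forall>x. f (- x) = f x}" (is "_ = ?E")
proof
  have sub: "fun_space.subspace ?E"
    by (auto simp: fun_space.subspace_def)
  show "E_even \<subseteq> ?E"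
    unfolding E_even_def
  proof (rule fun_space.span_minimal[OF _ sub], safe)
    fix k and x :: "'p mod_ring" assume "k \<in> {0..half CARD('p)}"
    then have k: "(of_nat (CARD('p) - k) :: 'p mod_ring) = - of_nat k"
      using half_le[of "CARD('p)"] by (intro of_nat_card_diff) simp
    show "(basis_vec (of_nat k) + basis_vec (of_nat (CARD('p) - k))) (- x) =
      (basis_vec (of_nat k) + basis_vec (of_nat (CARD('p) - k))) x"
      unfolding k by (rule basis_pair_reflect)
  qed
  have mem: "basis_vec (of_nat k) + basis_vec (- of_nat k) \<in> (E_even :: ('p mod_ring \<Rightarrow> complex) set)"
    if "k \<le> half CARD('p)" for k
  proof -
    have "k \<le> CARD('p)" using that half_le[of "CARD('p)"] by linarith
    then have "basis_vec (of_nat k) + basis_vec (- of_nat k) =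
        (basis_vec (of_nat k) + basis_vec (of_nat (CARD('p) - k)) :: 'p mod_ring \<Rightarrow> complex)"
      by (simp only: of_nat_card_diff)
    moreover have "k \<in> {0..half CARD('p)}" using that by simp
    ultimately show ?thesis unfolding E_even_def by (intro fun_space.span_base) blast
  qed
  have S: "fun_space.subspace (E_even :: ('p mod_ring \<Rightarrow> complex) set)"
    by (simp add: E_even_def)
  have "(basis_vec 0 :: 'p mod_ring \<Rightarrow> complex) = (1 / 2) *\<^sub>F (basis_vec (of_nat 0) + basis_vec (- of_nat 0))"
    by (simp add: fun_eq_iff)
  then have zero: "basis_vec 0 \<in> (E_even :: ('p mod_ring \<Rightarrow> complex) set)"
    using mem[of 0] fun_space.subspace_scale[OF S] by (metis le0)
  show "?E \<subseteq> E_even"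
  proof
    fix f assume "f \<in> ?E"
    then have "f = f 0 *\<^sub>F basis_vec 0 +
      (\<Sum>k = 1..half CARD('p). f (of_nat k) *\<^sub>F (basis_vec (of_nat k) + basis_vec (- of_nat k)))"
      by (intro even_expansion p) simp
    also have "\<dots> \<in> E_even"
    proof (rule fun_space.subspace_add[OF S])
      show "f 0 *\<^sub>F basis_vec 0 \<in> (E_even :: ('p mod_ring \<Rightarrow> complex) set)" by (rule fun_space.subspace_scale[OF S zero])
      show "(\<Sum>k = 1..half CARD('p). f (of_nat k) *\<^sub>F (basis_vec (of_nat k) + basis_vec (- of_nat k))) \<in>
          (E_even :: ('p mod_ring \<Rightarrow> complex) set)"
        by (rule fun_space.subspace_sum[OF S], rule fun_space.subspace_scale[OF S], rule mem) simp
    qed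
    finally show "f \<in> E_even" .
  qed
qed

text \<open>The even functions are the fixed points of the reflection \<open>x \<mapsto> - x\<close>, so a bijection that commutes
with the reflection permutes them.\<close>

lemma image_E_even:
  fixes W :: "('p::prime_card mod_ring \<Rightarrow> complex) \<Rightarrow> 'p mod_ring \<Rightarrow> complex"
  assumes p: "CARD('p) \<ge> 3" and W: "bij W"
    and refl: "\<And>f. W (\<lambda>x. f (- x)) = (\<lambda>x. W f (- x))"
  shows "W ` E_even = E_even"
proof -
  have E: "f \<in> E_even \<longleftrightarrow> (\<lambda>x. f (- x)) = f" for f :: "'p mod_ring \<Rightarrow> complex"
    by (auto simp: E_even_eq[OF p] fun_eq_iff)
  have iff: "W f \<in> E_even \<longleftrightarrow> f \<in> E_even" for f
    unfolding E refl [symmetric] using W by (simp only: bij_is_inj inj_eq)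
  show ?thesis
  proof
    show "W ` E_even \<subseteq> E_even" using iff by blast
    show "E_even \<subseteq> W ` E_even"
    proof
      fix g assume g: "g \<in> (E_even :: ('p mod_ring \<Rightarrow> complex) set)"
      obtain f where f: "g = W f" by (rule surjE[OF bij_is_surj[OF W]])
      then have "f \<in> E_even" using g iff by simp
      with f show "g \<in> W ` E_even" by (rule image_eqI)
    qed
  qed
qed

lemma fourier_reflect: "fourier (\<lambda>x. f (- x)) = (\<lambda>x. fourier f (- x))"
proof
  fix j
  have "(\<Sum>k\<in>UNIV. std_char (j * k) * f (- k)) = (\<Sum>k\<in>UNIV. std_char (- j * k) * f k)"
    by (rule sum.reindex_bij_witness[of _ uminus uminus]) auto
  then show "fourier (\<lambda>x. f (- x)) j = fourier f (- j)" by (simp add: fourier_def)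
qed

lemma chirp_reflect: "chirp (\<lambda>x. f (- x)) = (\<lambda>x. chirp f (- x))"
  by (simp add: chirp_def)

section \<open>The modular data on the subspace \<open>H2\<close>\<close>

lemma finite_objs: "finite (objs p)"
  by (simp add: objs_def)

lemma linear_ext_basis_vec:
  assumes "b \<in> objs p"
  shows "linear_ext p g (basis_vec b) = g b"
proof -
  have "basis_vec b \<in> H p"
    unfolding H_def using assms by (intro fun_space.span_base imageI)
  then have "linear_ext p g (basis_vec b) = (\<Sum>c\<in>objs p. basis_vec b c *\<^sub>F g c)"
    by (simp only: linear_ext_def restrict_apply')
  also have "\<dots> = (\<Sum>c\<in>objs p. if c = b then g b else 0)"
    by (rule sum.cong) (auto simp: basis_vec_def fun_eq_iff)
  also have "\<dots> = g b"
    using assms finite_objs by (simp only: sum.delta if_True)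
  finally show ?thesis .
qed

lemma subspace_H2: "fun_space.subspace (H2 p)" and subspace_H: "fun_space.subspace (H p)"
  by (simp_all add: H2_def H_def)

lemma gen_mem_H2: "vI + vZ \<in> H2 p" "j \<in> {1..half p} \<Longrightarrow> vY j \<in> H2 p"
  unfolding H2_def by (rule fun_space.span_base; blast)+

lemma basis_vec_mem_H: "b \<in> objs p \<Longrightarrow> basis_vec b \<in> H p"
  unfolding H_def by (intro fun_space.span_base imageI)

lemma obj_mem: "ObjI \<in> objs p" "ObjZ \<in> objs p" "j \<in> {1..half p} \<Longrightarrow> ObjY j \<in> objs p"
  unfolding objs_def by blast+

lemma H2_subset_H: "H2 p \<subseteq> H p"
  unfolding H2_def
proof (rule fun_space.span_minimal[OF _ subspace_H])
  show "insert (vI + vZ) {vY j |j. j \<in> {1..half p}} \<subseteq> H p"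
    using basis_vec_mem_H obj_mem by (auto simp del: plus_fun_apply intro!: fun_space.subspace_add[OF subspace_H])
qed

lemma odd_half: "odd p \<Longrightarrow> 2 * half p + 1 = p"
  unfolding half_def by presburger

text \<open>The twists are the values of the quadratic phase of \<open>tau\<close> because \<open>r = (p - 1)/2\<close> represents
\<open>- 1/2\<close> modulo \<open>p\<close>.\<close>

lemma theta_eq_std_char:
  assumes "CARD('p::prime_card) \<ge> 3"
  shows "theta CARD('p) j = std_char (- ((of_nat j :: 'p mod_ring) ^ 2 / 2))"
proof -
  let ?h = "of_nat (half CARD('p)) :: 'p mod_ring"
  have "odd CARD('p)" using prime_odd_nat[OF prime_card[where 'a = 'p]] assms by simp
  then have "2 * half CARD('p) + 1 = CARD('p)" by (rule odd_half)
  then have "of_nat (2 * half CARD('p) + 1) = (0 :: 'p mod_ring)"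
    by (simp only: of_nat_card_eq_0)
  then have "2 * ?h = - 1" by (simp add: eq_neg_iff_add_eq_0 add.commute)
  then have h: "?h = - 1 / 2"
    using two_neq_0_mod_ring[OF assms] by (metis nonzero_mult_div_cancel_left)
  have "theta CARD('p) j = std_char (of_nat (half CARD('p) * j\<^sup>2) :: 'p mod_ring)"
    by (simp only: theta_def std_char_of_nat)
  also have "(of_nat (half CARD('p) * j\<^sup>2) :: 'p mod_ring) = - ((of_nat j) ^ 2 / 2)"
    by (simp add: h)
  finally show ?thesis .
qed

text \<open>The map \<open>\<Phi>\<close> identifies \<open>1 + Z\<close> with \<open>2 f(0)\<close> and \<open>Y(j)\<close> with \<open>f(j) + f(-j)\<close>. Thus \<open>2 f(0)\<close> is the
instance \<open>j = 0\<close> of the general formula, which is where the factor two comes from.\<close>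

locale even_identification =
  fixes \<Phi> :: "(obj \<Rightarrow> complex) \<Rightarrow> ('p::prime_card mod_ring \<Rightarrow> complex)"
  assumes three: "CARD('p) \<ge> 3"
    and \<Phi>_linear: "linear_on (H2 CARD('p)) \<Phi>" and \<Phi>_bij: "bij_betw \<Phi> (H2 CARD('p)) E_even"
    and \<Phi>_1Z: "\<Phi> (vI + vZ) = 2 *\<^sub>F basis_vec 0"
    and \<Phi>_Y: "\<And>j. j \<in> {1..half CARD('p)} \<Longrightarrow> \<Phi> (vY j) = basis_vec (of_nat j) + basis_vec (- of_nat j)"
begin

text \<open>To compute \<open>\<Phi>\<close> of a vector given by coordinates it is enough to exhibit an even function whose
values at \<open>0, \<dots>, r\<close> are these coordinates, the one at \<open>0\<close> doubled. This turns each
comparison of matrices into an evaluation of a Fourier transform at the points \<open>0, \<dots>, r\<close>.\<close>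

lemma \<Phi>_eqI:
  assumes even: "\<And>x. f (- x) = f x" and zero: "f 0 = 2 * a"
    and Y: "\<And>k. k \<in> {1..half CARD('p)} \<Longrightarrow> f (of_nat k) = c k"
  shows "a *\<^sub>F (vI + vZ) + (\<Sum>k = 1..half CARD('p). c k *\<^sub>F vY k) \<in> H2 CARD('p)" (is "?u + ?w \<in> _")
    and "\<Phi> (a *\<^sub>F (vI + vZ) + (\<Sum>k = 1..half CARD('p). c k *\<^sub>F vY k)) = f"
proof -
  have u: "?u \<in> H2 CARD('p)"
    by (intro fun_space.subspace_scale[OF subspace_H2] gen_mem_H2)
  have w: "?w \<in> H2 CARD('p)"
    by (intro fun_space.subspace_sum[OF subspace_H2] fun_space.subspace_scale[OF subspace_H2] gen_mem_H2(2))
  show "?u + ?w \<in> H2 CARD('p)" by (rule fun_space.subspace_add[OF subspace_H2 u w])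
  have "\<Phi> (?u + ?w) = \<Phi> ?u + \<Phi> ?w"
    using \<Phi>_linear u w unfolding linear_on_def by blast
  also have "\<Phi> ?u = a *\<^sub>F \<Phi> (vI + vZ)"
    using \<Phi>_linear gen_mem_H2(1) unfolding linear_on_def by blast
  also have "\<dots> = f 0 *\<^sub>F basis_vec 0"
    by (simp only: \<Phi>_1Z fscale_fscale zero mult.commute)
  also have "\<Phi> ?w = (\<Sum>k = 1..half CARD('p). c k *\<^sub>F \<Phi> (vY k))"
    by (rule linear_on_sum[OF \<Phi>_linear subspace_H2]) (simp_all add: gen_mem_H2)
  also have "\<dots> = (\<Sum>k = 1..half CARD('p). f (of_nat k) *\<^sub>F (basis_vec (of_nat k) + basis_vec (- of_nat k)))"
    by (rule sum.cong) (simp_all only: \<Phi>_Y Y)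
  also have "f 0 *\<^sub>F basis_vec 0 + \<dots> = f"
    by (rule even_expansion[OF three, where f = f, OF even, symmetric])
  finally show "\<Phi> (?u + ?w) = f" .
qed

text \<open>Both the invariance of \<open>H2\<close> and the intertwining relation are linear in the vector, hence follow
from the spanning vectors.\<close>

lemma intertwines_on_H2:
  assumes M: "linear_on (H CARD('p)) M" and W: "linear_on UNIV W"
    and mem: "M (vI + vZ) \<in> H2 CARD('p)" "\<And>j. j \<in> {1..half CARD('p)} \<Longrightarrow> M (vY j) \<in> H2 CARD('p)"
    and eq: "\<Phi> (M (vI + vZ)) = W (\<Phi> (vI + vZ))"
      "\<And>j. j \<in> {1..half CARD('p)} \<Longrightarrow> \<Phi> (M (vY j)) = W (\<Phi> (vY j))"
    and v: "v \<in> H2 CARD('p)"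
  shows "M v \<in> H2 CARD('p)" "\<Phi> (M v) = W (\<Phi> v)"
proof -
  let ?V = "H2 CARD('p)" and ?B = "insert (vI + vZ) {vY j |j. j \<in> {1..half CARD('p)}}"
  have M2: "linear_on ?V M" by (rule linear_on_subset[OF M H2_subset_H])
  have add: "M (u + w) = M u + M w" if "u \<in> ?V" "w \<in> ?V" for u w
    using M2 that unfolding linear_on_def by blast
  have scale: "M (c *\<^sub>F u) = c *\<^sub>F M u" if "u \<in> ?V" for c u
    using M2 that unfolding linear_on_def by blast
  (* The vectors of H2 that M maps into H2 form a subspace containing the spanning vectors. *)
  have "?V \<subseteq> {u \<in> ?V. M u \<in> ?V}"
    unfolding H2_def[of "CARD('p)"]
  proof (rule fun_space.span_minimal, fold H2_def[of "CARD('p)"])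
    show "?B \<subseteq> {u \<in> ?V. M u \<in> ?V}" using gen_mem_H2 mem by blast
    show "fun_space.subspace {u \<in> ?V. M u \<in> ?V}"
    proof (rule fun_space.subspaceI)
      have z: "0 \<in> ?V" by (rule fun_space.subspace_0[OF subspace_H2])
      have "M (0 *\<^sub>F 0) = 0 *\<^sub>F M 0" by (rule scale[OF z])
      then have "M 0 = 0" by (simp only: fun_space.scale_zero_left)
      then show "0 \<in> {u \<in> ?V. M u \<in> ?V}" using z by (simp only: mem_Collect_eq simp_thms)
    next
      fix u w assume "u \<in> {u \<in> ?V. M u \<in> ?V}" "w \<in> {u \<in> ?V. M u \<in> ?V}"
      then have uw: "u \<in> ?V" "w \<in> ?V" "M u \<in> ?V" "M w \<in> ?V" by blast+
      have "M (u + w) \<in> ?V"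
        unfolding add[OF uw(1,2)] by (rule fun_space.subspace_add[OF subspace_H2 uw(3,4)])
      then show "u + w \<in> {u \<in> ?V. M u \<in> ?V}"
        using fun_space.subspace_add[OF subspace_H2 uw(1,2)] by blast
    next
      fix c u assume "u \<in> {u \<in> ?V. M u \<in> ?V}"
      then have u: "u \<in> ?V" "M u \<in> ?V" by blast+
      have "M (c *\<^sub>F u) \<in> ?V"
        unfolding scale[OF u(1)] by (rule fun_space.subspace_scale[OF subspace_H2 u(2)])
      then show "c *\<^sub>F u \<in> {u \<in> ?V. M u \<in> ?V}"
        using fun_space.subspace_scale[OF subspace_H2 u(1)] by blast
    qed
  qed
  then have inv: "M ` ?V \<subseteq> ?V" by blast
  then show "M v \<in> ?V" using v by blast
  have "(\<Phi> \<circ> M) v = (W \<circ> \<Phi>) v"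
  proof (rule linear_on_eq_on_span[where B = ?B], fold H2_def)
    show "linear_on ?V (\<Phi> \<circ> M)" by (rule linear_on_compose[OF M2 inv \<Phi>_linear])
    show "linear_on ?V (W \<circ> \<Phi>)" by (rule linear_on_compose[OF \<Phi>_linear _ W]) blast
    show "v \<in> ?V" by (rule v)
    fix b assume "b \<in> ?B"
    then consider "b = vI + vZ" | j where "j \<in> {1..half CARD('p)}" "b = vY j" by blast
    then show "(\<Phi> \<circ> M) b = (W \<circ> \<Phi>) b"
      by cases (simp_all only: comp_apply eq)
  qed
  then show "\<Phi> (M v) = W (\<Phi> v)" by (simp only: comp_apply)
qed

lemma fourier_1Z: "fourier (2 *\<^sub>F basis_vec 0) = (\<lambda>j :: 'p mod_ring. 2 / of_real (sqrt CARD('p)))"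
  by (simp add: fourier_def fun_eq_iff basis_vec_def if_distrib cong: if_cong)

lemma fourier_Y:
  "fourier (basis_vec a + basis_vec (- a)) =
    (\<lambda>j :: 'p mod_ring. 1 / of_real (sqrt CARD('p)) * (std_char (j * a) + std_char (- (j * a))))"
proof
  fix j :: "'p mod_ring"
  have delta: "(\<Sum>k\<in>UNIV. std_char (j * k) * basis_vec b k) = std_char (j * b)" for b :: "'p mod_ring"
    by (simp add: basis_vec_def if_distrib cong: if_cong)
  show "fourier (basis_vec a + basis_vec (- a)) j =
    1 / of_real (sqrt CARD('p)) * (std_char (j * a) + std_char (- (j * a)))"
    by (simp only: fourier_def plus_fun_apply distrib_left sum.distrib delta mult_minus_right)
qed

text \<open>The S-matrix is the Fourier transform written in the even basis: the factors
\<open>\<zeta>\<^bsup>jk\<^esup> + \<zeta>\<^bsup>-jk\<^esup>\<close> are the sums of the characters over the pair \<open>\<plusminus>j\<close>, and the \<open>X\<close>-components of the images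
of \<open>1\<close> and \<open>Z\<close> cancel.\<close>

lemma sigma_intertwines:
  assumes M: "linear_on (H CARD('p)) (linear_ext CARD('p) (sigma_image CARD('p)))" (is "linear_on _ ?M")
    and v: "v \<in> H2 CARD('p)"
  shows "?M v \<in> H2 CARD('p)" "\<Phi> (?M v) = fourier (\<Phi> v)"
proof -
  let ?p = "CARD('p)"
  let ?s = "1 / complex_of_real (sqrt ?p)"
  have "?M (vI + vZ) = ?M vI + ?M vZ"
    using M basis_vec_mem_H obj_mem unfolding linear_on_def by blast
  also have "\<dots> = sigma_image ?p ObjI + sigma_image ?p ObjZ"
    by (simp only: linear_ext_basis_vec obj_mem)
  also have "\<dots> = ?s *\<^sub>F (vI + vZ) + (\<Sum>k = 1..half ?p. (2 * ?s) *\<^sub>F vY k)"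
    by (rule ext) (simp add: sum_fun_apply sum_distrib_left field_simps sum.distrib flip: sum_divide_distrib)
  finally have I: "?M (vI + vZ) = ?s *\<^sub>F (vI + vZ) + (\<Sum>k = 1..half ?p. (2 * ?s) *\<^sub>F vY k)" .
  have Y: "?M (vY j) = ?s *\<^sub>F (vI + vZ) + (\<Sum>k = 1..half ?p.
      (?s * (zeta ?p ^ (k * j) + inverse (zeta ?p) ^ (k * j))) *\<^sub>F vY k)" if "j \<in> {1..half ?p}" for j
    using that by (simp only: linear_ext_basis_vec obj_mem sigma_image.simps)
  have fI: "fourier (2 *\<^sub>F basis_vec 0 :: 'p mod_ring \<Rightarrow> complex) (- x) = fourier (2 *\<^sub>F basis_vec 0) x"
    "fourier (2 *\<^sub>F basis_vec 0 :: 'p mod_ring \<Rightarrow> complex) 0 = 2 * ?s"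
    "fourier (2 *\<^sub>F basis_vec 0 :: 'p mod_ring \<Rightarrow> complex) (of_nat k) = 2 * ?s" for x k
    by (simp_all add: fourier_1Z)
  have fY: "fourier (basis_vec a + basis_vec (- a)) (- x) = fourier (basis_vec a + basis_vec (- a)) x"
    "fourier (basis_vec a + basis_vec (- a)) 0 = 2 * ?s" for a x :: "'p mod_ring"
    by (simp_all add: fourier_Y add.commute)
  have fYk: "fourier (basis_vec (of_nat j) + basis_vec (- of_nat j) :: 'p mod_ring \<Rightarrow> complex) (of_nat k) =
      ?s * (zeta ?p ^ (k * j) + inverse (zeta ?p) ^ (k * j))" for j k
    by (simp only: fourier_Y of_nat_mult [symmetric] std_char_minus std_char_of_nat power_inverse)
  have gens: "?M (vI + vZ) \<in> H2 ?p" "\<Phi> (?M (vI + vZ)) = fourier (\<Phi> (vI + vZ))"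
    unfolding I \<Phi>_1Z by (rule \<Phi>_eqI[OF fI])+
  have gens_Y: "?M (vY j) \<in> H2 ?p" "\<Phi> (?M (vY j)) = fourier (\<Phi> (vY j))"
    if j: "j \<in> {1..half ?p}" for j
    unfolding Y[OF j] \<Phi>_Y[OF j] by (rule \<Phi>_eqI[OF fY fYk])+
  note intertwines = intertwines_on_H2[OF M linear_on_fourier gens(1) gens_Y(1) gens(2) gens_Y(2) v]
  show "?M v \<in> H2 ?p" by (rule intertwines(1))
  show "\<Phi> (?M v) = fourier (\<Phi> v)" by (rule intertwines(2))
qed

text \<open>The quadratic phase is even in \<open>j\<close> and so acts by the same scalar on both halves of
\<open>basis_vec j + basis_vec (- j)\<close>.\<close>

lemma tau_intertwines:
  assumes M: "linear_on (H CARD('p)) (linear_ext CARD('p) (tau_image CARD('p)))" (is "linear_on _ ?M")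
    and v: "v \<in> H2 CARD('p)"
  shows "?M v \<in> H2 CARD('p)" "\<Phi> (?M v) = chirp (\<Phi> v)"
proof -
  let ?p = "CARD('p)"
  have "?M (vI + vZ) = ?M vI + ?M vZ"
    using M basis_vec_mem_H obj_mem unfolding linear_on_def by blast
  also have "\<dots> = vI + vZ"
    by (simp only: linear_ext_basis_vec obj_mem tau_image.simps)
  finally have I: "?M (vI + vZ) = vI + vZ" .
  have Y: "?M (vY j) = theta ?p j *\<^sub>F vY j" if "j \<in> {1..half ?p}" for j
    using that by (simp only: linear_ext_basis_vec obj_mem tau_image.simps)
  have \<Phi>Y: "\<Phi> (theta ?p j *\<^sub>F vY j) = theta ?p j *\<^sub>F \<Phi> (vY j)" if "j \<in> {1..half ?p}" for j
    using \<Phi>_linear gen_mem_H2(2)[OF that] unfolding linear_on_def by blast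
  have cI: "chirp (2 *\<^sub>F basis_vec 0) = (2 *\<^sub>F basis_vec 0 :: 'p mod_ring \<Rightarrow> complex)"
    by (simp add: chirp_def basis_vec_def fun_eq_iff)
  have cY: "chirp (basis_vec (of_nat j) + basis_vec (- of_nat j)) =
      theta ?p j *\<^sub>F (basis_vec (of_nat j) + basis_vec (- of_nat j) :: 'p mod_ring \<Rightarrow> complex)" for j
    by (auto simp: chirp_def basis_vec_def fun_eq_iff theta_eq_std_char[OF three])
  have gens: "?M (vI + vZ) \<in> H2 ?p" "\<Phi> (?M (vI + vZ)) = chirp (\<Phi> (vI + vZ))"
    unfolding I \<Phi>_1Z by (rule gen_mem_H2(1), rule cI [symmetric])
  have gens_Y: "?M (vY j) \<in> H2 ?p" "\<Phi> (?M (vY j)) = chirp (\<Phi> (vY j))"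
    if j: "j \<in> {1..half ?p}" for j
    unfolding Y[OF j] \<Phi>Y[OF j] \<Phi>_Y[OF j]
    by (rule fun_space.subspace_scale[OF subspace_H2 gen_mem_H2(2)[OF j]], rule cY [symmetric])
  note intertwines = intertwines_on_H2[OF M weilD(2)[OF chirp_in_weil[OF three]]
      gens(1) gens_Y(1) gens(2) gens_Y(2) v]
  show "?M v \<in> H2 ?p" by (rule intertwines(1))
  show "\<Phi> (?M v) = chirp (\<Phi> v)" by (rule intertwines(2))
qed

text \<open>The relation between representatives that is carried along products. Only \<open>W\<close> is required to
restrict to a bijection; for \<open>M\<close> invariance of \<open>H2\<close> is enough, because \<open>\<Phi>\<close> transports
the bijectivity of \<open>W\<close>.\<close>

definition agree_on_H2 ::
    "((obj \<Rightarrow> complex) \<Rightarrow> obj \<Rightarrow> complex) \<Rightarrow> (('p mod_ring \<Rightarrow> complex) \<Rightarrow> 'p mod_ring \<Rightarrow> complex) \<Rightarrow> bool"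
  where "agree_on_H2 M W \<longleftrightarrow> W ` E_even = E_even \<and> (\<forall>v \<in> H2 CARD('p). M v \<in> H2 CARD('p) \<and> \<Phi> (M v) = W (\<Phi> v))"

lemma agree_on_H2_compose:
  assumes "agree_on_H2 M W" "agree_on_H2 M' W'"
  shows "agree_on_H2 (compose (H CARD('p)) M M') (W \<circ> W')"
proof -
  have "(W \<circ> W') ` E_even = E_even" using assms by (simp only: agree_on_H2_def image_comp [symmetric])
  moreover have "compose (H CARD('p)) M M' v = M (M' v)" if "v \<in> H2 CARD('p)" for v
    using that H2_subset_H by (auto simp: compose_def)
  ultimately show ?thesis using assms by (simp add: agree_on_H2_def)
qed

text \<open>A single pair of matching representatives decides the equality of classes: each side consists of
all nonzero multiples of its representative, by the definition of \<open>PGL\<close> on the left and by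
Schur's lemma on the right.\<close>

lemma conj_class_eq_weil_even:
  assumes C: "C \<in> carrier (PGL (H CARD('p)))" and M: "M \<in> C"
    and W: "W \<in> weil std_char \<alpha>" and agree: "agree_on_H2 M W"
  shows "conj_class (H2 CARD('p)) E_even \<Phi> (restrict_class (H2 CARD('p)) C) \<in> carrier (PGL E_even)"
    and "conj_class (H2 CARD('p)) E_even \<Phi> (restrict_class (H2 CARD('p)) C) = weil_even std_char \<alpha>"
proof -
  let ?V = "H CARD('p)" and ?U = "H2 CARD('p)"
  let ?E = "E_even :: ('p mod_ring \<Rightarrow> complex) set"
  let ?conj = "\<lambda>N. restrict (\<Phi> \<circ> restrict N ?U \<circ> inv_into ?U \<Phi>) ?E"
  have subE: "fun_space.subspace ?E" by (simp add: E_even_def)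
  have MB: "M \<in> Bij ?V" using PGL_eq_proj_class(1)[OF subspace_H C M] by (simp add: carrier_GL)
  have Ceq: "C = {\<lambda>v\<in>?V. c *\<^sub>F M v | c. c \<noteq> 0}"
    using PGL_eq_proj_class(2)[OF subspace_H C M] proj_class_eq[OF subspace_H MB] by simp
  have conj: "?conj (\<lambda>v\<in>?V. c *\<^sub>F M v) = restrict (\<lambda>f. c *\<^sub>F W f) ?E" for c
  proof (rule restrict_ext)
    fix f assume f: "f \<in> ?E"
    let ?u = "inv_into ?U \<Phi> f"
    have fU: "f \<in> \<Phi> ` ?U" using f \<Phi>_bij by (simp add: bij_betw_def)
    have u: "?u \<in> ?U" by (rule inv_into_into[OF fU])
    then have uV: "?u \<in> ?V" using H2_subset_H by blast
    have Mu: "M ?u \<in> ?U" "\<Phi> (M ?u) = W (\<Phi> ?u)" using agree u by (simp_all only: agree_on_H2_def)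
    have "(\<Phi> \<circ> restrict (\<lambda>v\<in>?V. c *\<^sub>F M v) ?U \<circ> inv_into ?U \<Phi>) f = \<Phi> (c *\<^sub>F M ?u)"
      by (simp only: comp_apply restrict_apply' u uV)
    also have "\<dots> = c *\<^sub>F \<Phi> (M ?u)"
      using \<Phi>_linear Mu(1) unfolding linear_on_def by blast
    also have "\<dots> = c *\<^sub>F W f" by (simp only: Mu(2) f_inv_into_f[OF fU])
    finally show "(\<Phi> \<circ> restrict (\<lambda>v\<in>?V. c *\<^sub>F M v) ?U \<circ> inv_into ?U \<Phi>) f = c *\<^sub>F W f" .
  qed
  have "conj_class ?U ?E \<Phi> (restrict_class ?U C) = ?conj ` C"
    by (simp only: conj_class_def restrict_class_def image_image)
  also have "\<dots> = {?conj (\<lambda>v\<in>?V. c *\<^sub>F M v) | c. c \<noteq> 0}"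
    by (simp only: Ceq setcompr_eq_image image_image)
  also have "\<dots> = {restrict (\<lambda>f. c *\<^sub>F W f) ?E | c. c \<noteq> 0}"
    unfolding conj ..
  finally have lhs: "conj_class ?U ?E \<Phi> (restrict_class ?U C) = {restrict (\<lambda>f. c *\<^sub>F W f) ?E | c. c \<noteq> 0}" .
  have "weil_even std_char \<alpha> = (\<lambda>N. restrict N ?E) ` {\<lambda>f. c *\<^sub>F W f | c. c \<noteq> 0}"
    by (simp only: weil_even_def restrict_class_def weil_eq_multiples[OF W])
  also have "\<dots> = {restrict (\<lambda>f. c *\<^sub>F W f) ?E | c. c \<noteq> 0}"
    by (simp only: setcompr_eq_image image_image)
  finally show "conj_class ?U ?E \<Phi> (restrict_class ?U C) = weil_even std_char \<alpha>"
    by (simp only: lhs)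
  have WE: "W ` ?E = ?E" using agree by (simp only: agree_on_H2_def)
  have "inj_on W ?E"
    using weilD(1)[OF W] by (auto simp: bij_def intro: inj_on_subset)
  then have "bij_betw W ?E ?E" using WE by (simp add: bij_betw_def)
  then have WB: "restrict W ?E \<in> Bij ?E" by (simp add: Bij_def)
  have "linear_on ?E (restrict W ?E)"
    unfolding linear_on_def
  proof (intro conjI ballI allI)
    fix f g and c assume f: "f \<in> ?E"
    show "restrict W ?E (c *\<^sub>F f) = c *\<^sub>F restrict W ?E f"
      by (simp only: restrict_apply' fun_space.subspace_scale[OF subE f] f weilD(4)[OF W])
    assume g: "g \<in> ?E"
    show "restrict W ?E (f + g) = restrict W ?E f + restrict W ?E g"
      by (simp only: restrict_apply' fun_space.subspace_add[OF subE f g] f g weilD(3)[OF W])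
  qed
  then have WGL: "restrict W ?E \<in> carrier (GL ?E)" using WB by (simp add: carrier_GL)
  have "restrict (\<lambda>f. c *\<^sub>F W f) ?E = (\<lambda>v\<in>?E. c *\<^sub>F restrict W ?E v)" for c
    by (rule restrict_ext) (simp only: restrict_apply')
  then have "conj_class ?U ?E \<Phi> (restrict_class ?U C) = proj_class ?E (restrict W ?E)"
    unfolding lhs proj_class_eq[OF subE WB] by (simp only:)
  then show "conj_class ?U ?E \<Phi> (restrict_class ?U C) \<in> carrier (PGL ?E)"
    using WGL by (simp only: carrier_PGL imageI)
qed

text \<open>No formula for the representation away from the generators is needed: both sides are
multiplicative, so representatives that match for two matrices have matching products.\<close>

lemma genus_one_agrees_with_weil:
  assumes rep: "is_genus_one_rep CARD('p) \<rho>" and \<gamma>: "det \<gamma> = 1"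
  shows "\<rho> \<gamma> \<in> carrier (PGL (H CARD('p))) \<and>
    (\<exists>M \<in> \<rho> \<gamma>. \<exists>W \<in> weil std_char (reduce_mod \<gamma>). agree_on_H2 M W)"
  using \<gamma>
proof (induction rule: SL2_int_induct)
  have hom: "\<rho> \<in> hom SL2 (PGL (H CARD('p)))"
    and \<rho>\<sigma>: "\<rho> sigma = proj_class (H CARD('p)) (linear_ext CARD('p) (sigma_image CARD('p)))"
    and \<rho>\<tau>: "\<rho> tau = proj_class (H CARD('p)) (linear_ext CARD('p) (tau_image CARD('p)))"
    using rep by (simp_all only: is_genus_one_rep_def)
  have carrier: "\<rho> \<alpha> \<in> carrier (PGL (H CARD('p)))" if "det \<alpha> = 1" for \<alpha>
    using hom_in_carrier[OF hom, of \<alpha>] that by (simp add: SL2_def)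
  have gen: "vI \<in> H CARD('p)" "vI \<noteq> 0"
  proof -
    show "vI \<in> H CARD('p)" by (rule basis_vec_mem_H[OF obj_mem(1)])
    show "vI \<noteq> 0"
    proof
      assume "vI = 0"
      from fun_cong[OF this, of ObjI] show False by (simp add: basis_vec_def)
    qed
  qed
  {
    case sigma
    let ?M = "linear_ext CARD('p) (sigma_image CARD('p))"
    have C: "proj_class (H CARD('p)) ?M \<in> carrier (PGL (H CARD('p)))"
      using carrier[of sigma] \<rho>\<sigma> by (simp add: det_2)
    note GL = proj_class_in_PGL_imp_GL[OF subspace_H gen C]
    have lin: "linear_on (H CARD('p)) ?M" using GL(1) by (simp add: carrier_GL)
    have "agree_on_H2 ?M fourier"
      using sigma_intertwines[OF lin] image_E_even[OF three bij_fourier fourier_reflect]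
      unfolding agree_on_H2_def by blast
    then show ?case using C GL(2) fourier_in_weil[OF three] unfolding \<rho>\<sigma> by blast
  next
    case tau
    let ?M = "linear_ext CARD('p) (tau_image CARD('p))"
    have C: "proj_class (H CARD('p)) ?M \<in> carrier (PGL (H CARD('p)))"
      using carrier[of tau] \<rho>\<tau> by (simp add: det_2)
    note GL = proj_class_in_PGL_imp_GL[OF subspace_H gen C]
    note chirp = chirp_in_weil[OF three]
    have lin: "linear_on (H CARD('p)) ?M" using GL(1) by (simp add: carrier_GL)
    have "agree_on_H2 ?M chirp"
      using tau_intertwines[OF lin] image_E_even[OF three weilD(1)[OF chirp] chirp_reflect]
      unfolding agree_on_H2_def by blast
    then show ?case using C GL(2) chirp unfolding \<rho>\<tau> by blast
  next
    case (mult \<alpha> \<beta>)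
    obtain M W where M: "M \<in> \<rho> \<alpha>" and W: "W \<in> weil std_char (reduce_mod \<alpha>)" and MW: "agree_on_H2 M W"
      using mult.IH(1) by blast
    obtain M' W' where M': "M' \<in> \<rho> \<beta>" and W': "W' \<in> weil std_char (reduce_mod \<beta>)" and MW': "agree_on_H2 M' W'"
      using mult.IH(2) by blast
    have "\<rho> (\<alpha> ** \<beta>) = \<rho> \<alpha> \<otimes>\<^bsub>PGL (H CARD('p))\<^esub> \<rho> \<beta>"
      using hom_mult[OF hom, of \<alpha> \<beta>] mult.hyps by (simp add: SL2_def)
    then have "compose (H CARD('p)) M M' \<in> \<rho> (\<alpha> ** \<beta>)"
      using mult_PGL_mem[OF subspace_H carrier carrier M M'] mult.hyps by simp
    moreover have "reduce_mod (\<alpha> ** \<beta>) = (reduce_mod \<alpha> ** reduce_mod \<beta> :: 'p mod_ring ^ 2 ^ 2)"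
      by (simp add: mat2_eq_iff reduce_mod_def mat2_mult_nth)
    then have "W \<circ> W' \<in> weil std_char (reduce_mod (\<alpha> ** \<beta>))"
      using weil_mult[OF W W'] by simp
    moreover have "\<rho> (\<alpha> ** \<beta>) \<in> carrier (PGL (H CARD('p)))"
      using carrier mult.hyps by (simp add: det_mul)
    ultimately show ?case using agree_on_H2_compose[OF MW MW'] by blast
  }
qed

end

section \<open>The comparison theorem\<close>

theorem theorem2:
  fixes p :: "nat"
    and \<phi> :: "'p::prime_card mod_ring \<Rightarrow> complex"
    and \<rho>\<^sub>1 :: "int ^ 2 ^ 2 \<Rightarrow> ((obj \<Rightarrow> complex) \<Rightarrow> (obj \<Rightarrow> complex)) set"
    and \<Phi> :: "(obj \<Rightarrow> complex) \<Rightarrow> ('p mod_ring \<Rightarrow> complex)"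
  assumes "p = CARD('p)" and "p \<ge> 5"
    and "\<phi> = std_char"
    and "is_genus_one_rep p \<rho>\<^sub>1"
    and "linear_on (H2 p) \<Phi>" and "bij_betw \<Phi> (H2 p) E_even"
    and "\<Phi> (vI + vZ) = 2 *\<^sub>F basis_vec 0"
    and "\<And>j. j \<in> {1..half p} \<Longrightarrow> \<Phi> (vY j) = basis_vec (of_nat j) + basis_vec (- of_nat j)"
  shows "\<forall>\<gamma> \<in> carrier SL2.
    conj_class (H2 p) E_even \<Phi> (restrict_class (H2 p) (\<rho>\<^sub>1 \<gamma>)) \<in> carrier (PGL E_even) \<and>
    conj_class (H2 p) E_even \<Phi> (restrict_class (H2 p) (\<rho>\<^sub>1 \<gamma>)) = weil_even \<phi> (reduce_mod \<gamma>)"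
proof
  fix \<gamma> :: "int ^ 2 ^ 2" assume "\<gamma> \<in> carrier SL2"
  then have det: "det \<gamma> = 1" by (simp add: SL2_def)
  interpret even_identification \<Phi>
  proof
    show "CARD('p) \<ge> 3" using assms(1,2) by simp
  qed (use assms in \<open>simp_all only:\<close>)
  have rep: "is_genus_one_rep CARD('p) \<rho>\<^sub>1" using assms(1,4) by simp
  obtain M W where "\<rho>\<^sub>1 \<gamma> \<in> carrier (PGL (H CARD('p)))" "M \<in> \<rho>\<^sub>1 \<gamma>"
      "W \<in> weil std_char (reduce_mod \<gamma>)" "agree_on_H2 M W"
    using genus_one_agrees_with_weil[OF rep det] by blast
  from conj_class_eq_weil_even[OF this]
  show "conj_class (H2 p) E_even \<Phi> (restrict_class (H2 p) (\<rho>\<^sub>1 \<gamma>)) \<in> carrier (PGL E_even) \<and>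
    conj_class (H2 p) E_even \<Phi> (restrict_class (H2 p) (\<rho>\<^sub>1 \<gamma>)) = weil_even \<phi> (reduce_mod \<gamma>)"
    unfolding assms(1,3) by (rule conjI)
qed

end
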